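(* Let $(R,\mathfrak m)$ be an $F$-finite noetherian local ring of prime characteristic $p$ and dimension $d$. The following are equivalent: (1) For every pair of $\mathfrak m$-primary ideals $I,J$ generated by systems of parameters, $$e(I,R)\ge\frac{d^d}{c^J(I)^d}\,e(J,R).$$ (2) For every pair of $\mathfrak m$-primary ideals $I,J$ generated by systems of parameters, $$e_{HK}(J,R)\le\left(\frac{c^J(I)}d\right)^d e_{HK}\!\left(J\tfrac RI,\tfrac RI\right).$$
   Context: $F$-finite means the Frobenius endomorphism is finite. $e(-,R)$ is the Hilbert–Samuel multiplicity. For a local ring $A$ of characteristic $p$ and a proper ideal $\mathfrak a$ with $A/\mathfrak a$ of finite length, $e_{HK}(\mathfrak a,A)=\lim_{n\to\infty}l(A/\mathfrak a^{[p^n]})/p^{n\dim A}$, where $\mathfrak a^{[p^n]}$ is the ideal generated by $p^n$-th powers of elements of $\mathfrak a$ and $l$ is length. The $F$-threshold is $c^J(I)=\lim_{n\to\infty}\frac1{p^n}\sup\{t\in\mathbb N: I^t\nsubseteq J^{[p^n]}\}$. *)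

theory Defs
  imports
    Complex_Main
    "HOL-Library.Extended_Nat"
    "HOL-Computational_Algebra.Primes"
    "HOL-Algebra.Ideal_Product"
    "HOL-Algebra.QuotRing"
    "HOL-Algebra.Ring_Divisibility"
    "HOL-Algebra.Module"
begin

section \<open>Rings\<close>

definition local_ring :: "('a, 'b) ring_scheme \<Rightarrow> 'a set \<Rightarrow> bool" where
  "local_ring R \<mm> \<longleftrightarrow>
     cring R \<and> maximalideal \<mm> R \<and> (\<forall>\<nn>. maximalideal \<nn> R \<longrightarrow> \<nn> = \<mm>)"

definition has_characteristic :: "('a, 'b) ring_scheme \<Rightarrow> nat \<Rightarrow> bool" where
  "has_characteristic R p \<longleftrightarrow>
     (\<forall>n::nat. add_pow R n \<one>\<^bsub>R\<^esub> = \<zero>\<^bsub>R\<^esub> \<longleftrightarrow> p dvd n)"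

text \<open>A ring homomorphism \<open>f\<close> from \<open>R\<close> to \<open>S\<close> is finite if \<open>S\<close> is finitely generated as
  an \<open>R\<close>-module via \<open>f\<close>.\<close>

definition finite_ring_hom ::
  "('a, 'b) ring_scheme \<Rightarrow> ('c, 'd) ring_scheme \<Rightarrow> ('a \<Rightarrow> 'c) \<Rightarrow> bool" where
  "finite_ring_hom R S f \<longleftrightarrow>
     f \<in> ring_hom R S \<and>
     (\<exists>A \<subseteq> carrier S. finite A \<and>
        (\<forall>s \<in> carrier S. \<exists>c \<in> A \<rightarrow> carrier R.
           s = (\<Oplus>\<^bsub>S\<^esub>a\<in>A. f (c a) \<otimes>\<^bsub>S\<^esub> a)))"

definition F_finite :: "nat \<Rightarrow> ('a, 'b) ring_scheme \<Rightarrow> bool" where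
  "F_finite p R \<longleftrightarrow> finite_ring_hom R R (\<lambda>x. x [^]\<^bsub>R\<^esub> p)"

text \<open>Supremum of the lengths of strict chains of prime ideals. The zero ring, which has no
  prime ideals, gets dimension 0 here.\<close>

definition krull_dim :: "('a, 'b) ring_scheme \<Rightarrow> enat" where
  "krull_dim R =
     (SUP n \<in> {n. \<exists>P. (\<forall>i\<le>n. primeideal (P i) R) \<and> (\<forall>i<n. P i \<subset> P (Suc i))}. enat n)"


section \<open>Ideals\<close>

definition radical :: "('a, 'b) ring_scheme \<Rightarrow> 'a set \<Rightarrow> 'a set" where
  "radical R I = {x \<in> carrier R. \<exists>n::nat. x [^]\<^bsub>R\<^esub> n \<in> I}"

definition primary_ideal :: "('a, 'b) ring_scheme \<Rightarrow> 'a set \<Rightarrow> bool" where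
  "primary_ideal R I \<longleftrightarrow>
     ideal I R \<and> I \<noteq> carrier R \<and>
     (\<forall>x \<in> carrier R. \<forall>y \<in> carrier R. x \<otimes>\<^bsub>R\<^esub> y \<in> I \<longrightarrow> x \<in> I \<or> y \<in> radical R I)"

definition m_primary :: "('a, 'b) ring_scheme \<Rightarrow> 'a set \<Rightarrow> 'a set \<Rightarrow> bool" where
  "m_primary R \<mm> I \<longleftrightarrow> primary_ideal R I \<and> radical R I = \<mm>"

definition system_of_parameters :: "('a, 'b) ring_scheme \<Rightarrow> 'a set \<Rightarrow> 'a list \<Rightarrow> bool" where
  "system_of_parameters R \<mm> xs \<longleftrightarrow>
     set xs \<subseteq> \<mm> \<and> enat (length xs) = krull_dim R \<and> m_primary R \<mm> (Idl\<^bsub>R\<^esub> (set xs))"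

definition parameter_ideal :: "('a, 'b) ring_scheme \<Rightarrow> 'a set \<Rightarrow> 'a set \<Rightarrow> bool" where
  "parameter_ideal R \<mm> I \<longleftrightarrow>
     m_primary R \<mm> I \<and> (\<exists>xs. system_of_parameters R \<mm> xs \<and> I = Idl\<^bsub>R\<^esub> (set xs))"

definition frobenius_power :: "nat \<Rightarrow> ('a, 'b) ring_scheme \<Rightarrow> 'a set \<Rightarrow> nat \<Rightarrow> 'a set" where
  "frobenius_power p R I n = Idl\<^bsub>R\<^esub> ((\<lambda>x. x [^]\<^bsub>R\<^esub> (p ^ n)) ` I)"

text \<open>\<open>extended_ideal R I J\<close> is the extension of \<open>J\<close> to \<open>R Quot I\<close>.\<close>

definition extended_ideal :: "('a, 'b) ring_scheme \<Rightarrow> 'a set \<Rightarrow> 'a set \<Rightarrow> 'a set set" where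
  "extended_ideal R I J = Idl\<^bsub>R Quot I\<^esub> ((\<lambda>x. I +>\<^bsub>R\<^esub> x) ` J)"


section \<open>Length\<close>

definition module_length ::
  "('a, 'b) ring_scheme \<Rightarrow> ('a, 'c, 'd) module_scheme \<Rightarrow> enat" where
  "module_length R M =
     (SUP n \<in> {n. \<exists>N. (\<forall>i\<le>n. submodule (N i) R M) \<and> (\<forall>i<n. N i \<subset> N (Suc i))}. enat n)"

definition quotient_module ::
  "('a, 'b) ring_scheme \<Rightarrow> 'a set \<Rightarrow> ('a, 'a set) module" where
  "quotient_module R I =
     \<lparr>carrier = carrier (R Quot I), mult = mult (R Quot I), one = one (R Quot I),
      zero = zero (R Quot I), add = add (R Quot I),
      smult = (\<lambda>r X. (I +>\<^bsub>R\<^esub> r) \<otimes>\<^bsub>R Quot I\<^esub> X)\<rparr>"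

text \<open>Here and in the multiplicities below, lengths and dimensions are passed through
  \<open>the_enat\<close>, which is only meaningful when they are finite. They are over a Noetherian
  local ring for ideals with quotient of finite length.\<close>

definition colength :: "('a, 'b) ring_scheme \<Rightarrow> 'a set \<Rightarrow> real" where
  "colength R I = real (the_enat (module_length R (quotient_module R I)))"


section \<open>Multiplicities and the F-threshold\<close>

text \<open>Powers of ideals are powers in the semiring \<open>ideals_set R\<close>; the zeroth power is
  \<open>carrier R\<close>.\<close>

definition hs_multiplicity :: "'a set \<Rightarrow> ('a, 'b) ring_scheme \<Rightarrow> real" where
  "hs_multiplicity I R =
     lim (\<lambda>n::nat. fact (the_enat (krull_dim R)) * colength R (I [^]\<^bsub>ideals_set R\<^esub> n)
                     / real n ^ the_enat (krull_dim R))"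

definition hk_multiplicity :: "nat \<Rightarrow> 'a set \<Rightarrow> ('a, 'b) ring_scheme \<Rightarrow> real" where
  "hk_multiplicity p \<aa> A =
     lim (\<lambda>n::nat. colength A (frobenius_power p A \<aa> n)
                     / real (p ^ (n * the_enat (krull_dim A))))"

text \<open>\<open>F_threshold p R J I\<close> is the F-threshold of \<open>I\<close> with respect to \<open>J\<close>. The supremum is taken in the reals; it is that of a
  bounded nonempty set whenever \<open>J\<close> is proper and some power of \<open>I\<close> lies in \<open>J\<close>, with
  \<open>J\<close> finitely generated.\<close>

definition F_threshold :: "nat \<Rightarrow> ('a, 'b) ring_scheme \<Rightarrow> 'a set \<Rightarrow> 'a set \<Rightarrow> real" where
  "F_threshold p R J I =
     lim (\<lambda>n::nat. (SUP t \<in> {t::nat. \<not> I [^]\<^bsub>ideals_set R\<^esub> t \<subseteq> frobenius_power p R J n}. real t)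
                     / real (p ^ n))"

end

theory Submission
  imports Defs "HOL-Library.List_Lexorder"
begin

text \<open>
  For a parameter ideal \<open>I = (x\<^sub>1, \<dots>, x\<^sub>d)\<close> one has \<open>e\<^sub>H\<^sub>K(I, R) = e(I, R) \<le> l(R/I)\<close> (Lech),
  and \<open>e\<^sub>H\<^sub>K(J R/I, R/I) = l(R/I)\<close> since \<open>R/I\<close> is Artinian. Writing \<open>c = c\<^sup>J(I)\<close>, (1) says
  \<open>e(J) \<le> (c/d)\<^sup>d e(I)\<close> and (2) says \<open>e(J) \<le> (c/d)\<^sup>d l(R/I)\<close>, so (1) implies (2). Conversely, apply
  (2) to \<open>(x\<^sub>1\<^sup>q, \<dots>, x\<^sub>d\<^sup>q)\<close>, whose F-threshold is at most \<open>c/q\<close>, and let \<open>q\<close> tend to infinity. If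
  \<open>c = 0\<close> and \<open>d > 0\<close>, where the quotient in (1) has the junk value 0, then \<open>e(J) \<le> l(R/I) c\<^sup>d = 0\<close>.

  Lech's lemma is obtained by counting. Let \<open>u\<^sub>1, u\<^sub>2, \<dots>\<close> be the generators of a composition series
  of \<open>R/I\<close>, and call \<open>(i, b)\<close> redundant if \<open>u\<^sub>i x\<^sup>b\<close> is generated by the monomials above \<open>x\<^sup>b\<close> in the
  graded lexicographic order and the \<open>u\<^sub>j x\<^sup>b\<close> with \<open>j < i\<close>. For fixed \<open>i\<close> the redundant
  exponents are closed upwards, so there are none of them, or all but a lower-order number
  of the exponents in a simplex or a box are redundant. Hence both multiplicities equal the
  number of those \<open>i\<close> without redundant exponents.
\<close>

section \<open>Colengths of ideals\<close>

definition ideal_chain :: "('a, 'b) ring_scheme \<Rightarrow> 'a set \<Rightarrow> nat \<Rightarrow> bool" where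
  "ideal_chain R I n \<longleftrightarrow>
     (\<exists>N. (\<forall>i\<le>n. ideal (N i) R \<and> I \<subseteq> N i) \<and> (\<forall>i<n. N i \<subset> N (Suc i)))"

definition has_colength :: "('a, 'b) ring_scheme \<Rightarrow> 'a set \<Rightarrow> nat \<Rightarrow> bool" where
  "has_colength R I n \<longleftrightarrow> ideal_chain R I n \<and> (\<forall>k. ideal_chain R I k \<longrightarrow> k \<le> n)"

lemma ideal_subset: "ideal I R \<Longrightarrow> I \<subseteq> carrier R"
  by (auto intro: ideal.Icarr)

lemma (in ring) ideal_chain_0: "ideal I R \<Longrightarrow> ideal_chain R I 0"
  unfolding ideal_chain_def by (intro exI[of _ "\<lambda>_. I"]) simp

lemma ideal_chain_mono: "ideal_chain R J n \<Longrightarrow> I \<subseteq> J \<Longrightarrow> ideal_chain R I n"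
  unfolding ideal_chain_def by (meson order_trans)

lemma ideal_chain_Suc:
  assumes "ideal_chain R F' n" "ideal F R" "F \<subset> F'"
  shows "ideal_chain R F (Suc n)"
proof -
  obtain N where N: "\<forall>i\<le>n. ideal (N i) R \<and> F' \<subseteq> N i" "\<forall>i<n. N i \<subset> N (Suc i)"
    using assms(1) unfolding ideal_chain_def by blast
  define M where "M i = (case i of 0 \<Rightarrow> F | Suc j \<Rightarrow> N j)" for i
  have "ideal (M i) R \<and> F \<subseteq> M i" if "i \<le> Suc n" for i
    using that N(1) assms(2,3) unfolding M_def by (auto split: nat.split)
  moreover have "M i \<subset> M (Suc i)" if "i < Suc n" for i
  proof (cases i)
    case 0
    then show ?thesis using N(1) assms(3) unfolding M_def by (simp add: psubset_subset_trans)
  next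
    case (Suc j)
    then show ?thesis using that N(2) unfolding M_def by simp
  qed
  ultimately show ?thesis unfolding ideal_chain_def by blast
qed

lemma (in ring) ideal_chain_cover:
  assumes chain: "ideal_chain R F (Suc n)" and F': "ideal F' R"
    and "F \<subseteq> F'"
    and cover: "\<And>N. ideal N R \<Longrightarrow> F \<subseteq> N \<Longrightarrow> N \<subseteq> F' \<Longrightarrow> N = F \<or> N = F'"
  shows "ideal_chain R F' n"
proof -
  obtain N where "\<forall>i\<le>Suc n. ideal (N i) R \<and> F \<subseteq> N i" "\<forall>i<Suc n. N i \<subset> N (Suc i)"
    using chain unfolding ideal_chain_def by blast
  then have N: "\<And>i. i \<le> Suc n \<Longrightarrow> ideal (N i) R" "\<And>i. i \<le> Suc n \<Longrightarrow> F \<subseteq> N i"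
    and strict: "\<And>i. i \<le> n \<Longrightarrow> N i \<subset> N (Suc i)"
    by (simp_all add: less_Suc_eq_le)
  define M where "M i = Idl (N i \<union> F')" for i
  have M_add: "M i = N i <+> F'" and M_ideal: "ideal (M i) R" and M_sup: "N i \<union> F' \<subseteq> M i"
    if "i \<le> Suc n" for i
  proof -
    have "N i \<union> F' \<subseteq> carrier R"
      using ideal_subset[OF N(1)[OF that]] ideal_subset[OF F'] by blast
    then show "ideal (M i) R" "N i \<union> F' \<subseteq> M i"
      unfolding M_def using genideal_ideal genideal_self by blast+
    show "M i = N i <+> F'"
      unfolding M_def using union_genideal[OF N(1)[OF that] F'] by simp
  qed
  have M_strict: "M i \<subset> M (Suc i)" if i: "i \<le> n" "N (Suc i) \<inter> F' = F" for i
  proof -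
    have "N i \<union> F' \<subseteq> M (Suc i)"
      using strict[of i] M_sup[of "Suc i"] i by auto
    then have sub: "M i \<subseteq> M (Suc i)"
      unfolding M_def[of i] using i by (intro genideal_minimal M_ideal) auto
    obtain y where y: "y \<in> N (Suc i)" "y \<notin> N i"
      using strict[OF i(1)] by blast
    have "y \<notin> M i"
    proof
      assume "y \<in> M i"
      then obtain a f where af: "a \<in> N i" "f \<in> F'" "y = a \<oplus> f"
        using M_add[of i] i unfolding set_add_def' by auto
      have carr: "a \<in> carrier R" "f \<in> carrier R"
        using af N(1)[of i] F' i ideal.Icarr by (metis le_SucI)+
      have id1: "ideal (N (Suc i)) R" using N(1) i by simp
      have "a \<in> N (Suc i)" using af strict[of i] i(1) by blast
      then have "\<ominus> a \<oplus> y \<in> N (Suc i)"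
        using y id1 additive_subgroup.a_closed additive_subgroup.a_inv_closed ideal.axioms(1) by meson
      moreover have "\<ominus> a \<oplus> y = f" using af carr by (simp add: r_neg1)
      ultimately have "f \<in> F" using i(2) af(2) by auto
      then have "f \<in> N i" using N(2)[of i] i by auto
      then have "y \<in> N i"
        using af N(1)[of i] i additive_subgroup.a_closed ideal.axioms(1) by (metis le_SucI)
      then show False using y by simp
    qed
    then show ?thesis using sub M_sup[of "Suc i"] y i by auto
  qed
  have int: "N i \<inter> F' = F \<or> F' \<subseteq> N i" if "i \<le> Suc n" for i
    using cover[of "N i \<inter> F'"] i_intersect[OF N(1)[OF that] F'] N(2)[OF that] assms(3) by blast
  show ?thesis
  proof (cases "\<exists>k\<le>Suc n. F' \<subseteq> N k")
    case False
    have "\<forall>i\<le>n. ideal (M i) R \<and> F' \<subseteq> M i" using M_ideal M_sup by auto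
    moreover have "\<forall>i<n. M i \<subset> M (Suc i)"
      using M_strict int False by auto
    ultimately show ?thesis unfolding ideal_chain_def by blast
  next
    case True
    define k where "k = (LEAST k. F' \<subseteq> N k)"
    have k: "F' \<subseteq> N k" unfolding k_def using True by (metis LeastI)
    have "k \<le> Suc n" unfolding k_def using True Least_le order_trans by metis
    note k = k this
    have least: "\<not> F' \<subseteq> N j" if "j < k" for j
      using not_less_Least that unfolding k_def by blast
    have up: "F' \<subseteq> N i" if "k \<le> i" "i \<le> Suc n" for i
      using that
    proof (induction i rule: dec_induct)
      case (step i) then show ?case using strict[of i] by auto
    qed (use k in simp)
    define P where "P i = (if Suc i < k then M i else N (Suc i))" for i
    have "ideal (P i) R \<and> F' \<subseteq> P i" if "i \<le> n" for i
      unfolding P_def using that M_ideal[of i] M_sup[of i] N(1)[of "Suc i"] up[of "Suc i"] by auto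
    moreover have "P i \<subset> P (Suc i)" if "i < n" for i
    proof -
      consider "Suc (Suc i) < k" | "Suc (Suc i) = k" | "k \<le> Suc i" by linarith
      then show ?thesis
      proof cases
        case 1
        then show ?thesis unfolding P_def using M_strict[of i] int[of "Suc i"] least[of "Suc i"] that by auto
      next
        case 2
        have "M i \<subset> M (Suc i)"
          using M_strict[of i] int[of "Suc i"] least[of "Suc i"] that 2 by auto
        moreover have "M (Suc i) \<subseteq> N k"
          unfolding M_def using N(1)[OF k(2)] k(1) strict[of "Suc i"] 2 that
          by (intro genideal_minimal) auto
        ultimately show ?thesis unfolding P_def using 2 by auto
      next
        case 3
        then show ?thesis unfolding P_def using strict[of "Suc i"] that by auto
      qed
    qed
    ultimately show ?thesis unfolding ideal_chain_def by blast
  qed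
qed

lemma (in ring) has_colength_carrier: "has_colength R (carrier R) 0"
proof -
  have "k = 0" if chain: "ideal_chain R (carrier R) k" for k
  proof (rule ccontr)
    assume "k \<noteq> 0"
    moreover obtain N where "\<forall>i\<le>k. ideal (N i) R \<and> carrier R \<subseteq> N i" "\<forall>i<k. N i \<subset> N (Suc i)"
      using chain unfolding ideal_chain_def by blast
    ultimately have "ideal (N 1) R" "carrier R \<subseteq> N 0" "N 0 \<subset> N 1" by auto
    then show False using ideal_subset[of "N 1" R] by auto
  qed
  then show ?thesis unfolding has_colength_def using ideal_chain_0[OF oneideal] by auto
qed

lemma has_colength_antimono:
  "has_colength R I a \<Longrightarrow> has_colength R J b \<Longrightarrow> I \<subseteq> J \<Longrightarrow> b \<le> a"
  unfolding has_colength_def using ideal_chain_mono by blast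

lemma (in ring) has_colength_superset:
  assumes "has_colength R I a" "I \<subseteq> J" "ideal J R"
  obtains b where "b \<le> a" "has_colength R J b"
proof -
  define S where "S = {k. ideal_chain R J k}"
  have bd: "S \<subseteq> {..a}"
    using assms(1,2) ideal_chain_mono unfolding S_def has_colength_def by blast
  moreover have "S \<noteq> {}" using ideal_chain_0[OF assms(3)] unfolding S_def by blast
  ultimately have "Max S \<in> S" "\<forall>k\<in>S. k \<le> Max S"
    using Max_in Max_ge finite_subset[OF bd] by auto
  then have "has_colength R J (Max S)" unfolding has_colength_def S_def by auto
  moreover have "Max S \<le> a" using \<open>Max S \<in> S\<close> bd by auto
  ultimately show ?thesis using that by blast
qed

lemma (in cring) Idl_insert_ideal:
  assumes "ideal F R" "u \<in> carrier R" "y \<in> Idl (insert u F)"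
  obtains f r where "f \<in> F" "r \<in> carrier R" "y = f \<oplus> r \<otimes> u"
proof -
  have uid: "ideal (PIdl u) R" using cgenideal_ideal assms by auto
  have sum: "ideal (F <+> PIdl u) R" using add_ideals[OF assms(1) uid] .
  have "F \<union> PIdl u \<subseteq> carrier R" using ideal_subset[OF assms(1)] ideal_subset[OF uid] by blast
  then have "F \<union> PIdl u \<subseteq> F <+> PIdl u"
    unfolding union_genideal[OF assms(1) uid, symmetric] by (rule genideal_self)
  then have "insert u F \<subseteq> F <+> PIdl u" using cgenideal_self[OF assms(2)] by blast
  then have "y \<in> F <+> PIdl u" using genideal_minimal[OF sum] assms(3) by blast
  then show ?thesis using that unfolding set_add_def' cgenideal_def by blast
qed

lemma (in cring) unit_modulo_maximal:
  assumes "maximalideal \<mm> R" "r \<in> carrier R" "r \<notin> \<mm>"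
  obtains s t where "s \<in> carrier R" "t \<in> \<mm>" "\<one> = t \<oplus> s \<otimes> r"
proof -
  interpret \<mm>: maximalideal \<mm> R by fact
  have sub: "insert r \<mm> \<subseteq> carrier R" using assms \<mm>.Icarr by blast
  have "r \<in> Idl (insert r \<mm>)" "\<mm> \<subseteq> Idl (insert r \<mm>)" using genideal_self[OF sub] by auto
  then have "Idl (insert r \<mm>) = carrier R"
    using \<mm>.I_maximal[OF genideal_ideal[OF sub]] assms(3) ideal.Icarr[OF genideal_ideal[OF sub]] by blast
  then have "\<one> \<in> Idl (insert r \<mm>)" by simp
  then show ?thesis using that Idl_insert_ideal[OF \<mm>.is_ideal assms(2)] by metis
qed

lemma (in cring) has_colength_insert:
  assumes "maximalideal \<mm> R" "ideal F R" "u \<in> carrier R"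
    and mu: "\<And>r. r \<in> \<mm> \<Longrightarrow> r \<otimes> u \<in> F"
    and len: "has_colength R (Idl (insert u F)) n"
  shows "has_colength R F (n + (if u \<in> F then 0 else 1))"
proof -
  interpret \<mm>: maximalideal \<mm> R by fact
  interpret F: ideal F R by fact
  define F' where "F' = Idl (insert u F)"
  have sub: "insert u F \<subseteq> carrier R" using assms F.Icarr by blast
  have F': "ideal F' R" "insert u F \<subseteq> F'" unfolding F'_def using genideal_ideal[OF sub] genideal_self[OF sub] by auto
  show ?thesis
  proof (cases "u \<in> F")
    case True
    then have "F' \<subseteq> F" unfolding F'_def using genideal_minimal[OF assms(2)] by blast
    then have "F' = F" using F' by blast
    then show ?thesis using True len unfolding F'_def by simp
  next
    case False
    have cover: "N = F \<or> N = F'" if N: "ideal N R" "F \<subseteq> N" "N \<subseteq> F'" for N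
    proof (rule disjCI)
      assume "N \<noteq> F'"
      interpret N: ideal N R by fact
      have "y \<in> F" if y: "y \<in> N" for y
      proof -
        obtain f r where fr: "f \<in> F" "r \<in> carrier R" "y = f \<oplus> r \<otimes> u"
          using Idl_insert_ideal[OF assms(2,3), of y] y N(3) unfolding F'_def by blast
        have fc: "f \<in> carrier R" using fr F.Icarr by blast
        show ?thesis
        proof (cases "r \<in> \<mm>")
          case True
          then show ?thesis using fr mu by simp
        next
          case False
          obtain s t where st: "s \<in> carrier R" "t \<in> \<mm>" "\<one> = t \<oplus> s \<otimes> r"
            using unit_modulo_maximal[OF assms(1) fr(2) False] .
          have tc: "t \<in> carrier R" using st \<mm>.Icarr by blast
          have "\<ominus> f \<oplus> y \<in> N" using fr(1) y N(2) by blast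
          then have ru: "r \<otimes> u \<in> N" using fr fc assms(3) by (simp add: r_neg1)
          have "u = \<one> \<otimes> u" using assms(3) by simp
          also have "\<dots> = (t \<oplus> s \<otimes> r) \<otimes> u" using st(3) by simp
          also have "\<dots> = t \<otimes> u \<oplus> s \<otimes> (r \<otimes> u)"
            using st tc fr assms(3) by (simp add: l_distr m_assoc)
          also have "\<dots> \<in> N" using mu[OF st(2)] N(2) N.I_l_closed[OF ru st(1)] by blast
          finally have "F' \<subseteq> N" unfolding F'_def using genideal_minimal[OF N(1)] N(2) by blast
          then show ?thesis using N \<open>N \<noteq> F'\<close> by blast
        qed
      qed
      then show "N = F" using N by blast
    qed
    have strict: "F \<subset> F'" using F' False by blast
    have "ideal_chain R F (Suc n)"
      using ideal_chain_Suc[OF _ assms(2) strict] len unfolding has_colength_def F'_def by blast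
    moreover have "k \<le> Suc n" if "ideal_chain R F k" for k
    proof (cases k)
      case (Suc j)
      then show ?thesis
        using ideal_chain_cover[OF _ F'(1) _ cover] strict that len
        unfolding has_colength_def F'_def by auto
    qed simp
    ultimately show ?thesis using False unfolding has_colength_def by simp
  qed
qed

lemma submodule_quotient_module_iff:
  assumes "cring R" "ideal I R"
  shows "submodule H R (quotient_module R I) \<longleftrightarrow> ideal H (R Quot I)"
proof -
  interpret cring R by fact
  interpret I: ideal I R by fact
  interpret Q: cring "R Quot I" using I.quotient_is_cring[OF assms(1)] .
  have carr: "carrier (R Quot I) = (\<lambda>x. I +>\<^bsub>R\<^esub> x) ` carrier R"
    unfolding FactRing_def A_RCOSETS_def' by auto
  have sub: "subgroup H (add_monoid (quotient_module R I)) \<longleftrightarrow> subgroup H (add_monoid (R Quot I))"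
    by (simp add: quotient_module_def subgroup_def m_inv_def)
  have smult: "a \<odot>\<^bsub>quotient_module R I\<^esub> X = (I +>\<^bsub>R\<^esub> a) \<otimes>\<^bsub>R Quot I\<^esub> X" for a X
    by (simp add: quotient_module_def)
  show ?thesis
  proof
    assume "submodule H R (quotient_module R I)"
    then interpret H: submodule H R "quotient_module R I" .
    have Hsub: "subgroup H (add_monoid (R Quot I))" using H.subgroup_axioms sub by blast
    have Hc: "H \<subseteq> carrier (R Quot I)" using subgroup.subset[OF Hsub] by simp
    show "ideal H (R Quot I)"
    proof (rule idealI[OF Q.ring_axioms Hsub])
      fix a x assume ax: "a \<in> H" "x \<in> carrier (R Quot I)"
      then show "x \<otimes>\<^bsub>R Quot I\<^esub> a \<in> H" using H.smult_closed[of _ a] smult carr by auto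
      then show "a \<otimes>\<^bsub>R Quot I\<^esub> x \<in> H" using Q.m_comm ax Hc by (metis subsetD)
    qed
  next
    assume "ideal H (R Quot I)"
    then interpret H: ideal H "R Quot I" .
    show "submodule H R (quotient_module R I)"
    proof (intro submodule.intro submodule_axioms.intro)
      show "subgroup H (add_monoid (quotient_module R I))" using H.a_subgroup sub by blast
    qed (auto simp: smult carr intro: H.I_l_closed)
  qed
qed

lemma (in ring) ideal_chain_quotient:
  assumes "ideal I R"
  shows "ideal_chain (R Quot I) {\<zero>\<^bsub>R Quot I\<^esub>} n \<longleftrightarrow> ideal_chain R I n"
proof -
  define f where "f = (\<lambda>J. (+>) I ` J)"
  define A where "A = {J. ideal J R \<and> I \<subseteq> J}"
  define B where "B = {J. ideal J (R Quot I)}"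
  have bij: "bij_betw f A B"
    using quot_ideal_correspondence[OF assms] unfolding f_def A_def B_def .
  have zero: "{\<zero>\<^bsub>R Quot I\<^esub>} \<subseteq> J" if "J \<in> B" for J
    using that additive_subgroup.zero_closed[OF ideal.axioms(1)] unfolding B_def by auto
  have inv: "\<Union> (f J) = J" if "J \<in> A" for J
    using that ideal_incl_iff[OF assms, of J] unfolding f_def A_def by auto
  have f_strict: "f J \<subset> f K \<longleftrightarrow> J \<subset> K" if "J \<in> A" "K \<in> A" for J K
    using inv[OF that(1)] inv[OF that(2)] unfolding f_def by (metis Union_mono image_mono psubset_eq)
  show ?thesis
  proof
    assume "ideal_chain (R Quot I) {\<zero>\<^bsub>R Quot I\<^esub>} n"
    then obtain N where N: "\<forall>i\<le>n. N i \<in> B" "\<forall>i<n. N i \<subset> N (Suc i)"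
      unfolding ideal_chain_def B_def by blast
    define M where "M i = inv_into A f (N i)" for i
    have "M i \<in> A \<and> f (M i) = N i" if "i \<le> n" for i
      using N(1) that bij unfolding M_def bij_betw_def by (metis f_inv_into_f inv_into_into)
    then have "(\<forall>i\<le>n. M i \<in> A) \<and> (\<forall>i<n. M i \<subset> M (Suc i))"
      using N(2) f_strict by (metis Suc_leI less_imp_le)
    then show "ideal_chain R I n" unfolding ideal_chain_def A_def by blast
  next
    assume "ideal_chain R I n"
    then obtain N where N: "\<forall>i\<le>n. N i \<in> A" "\<forall>i<n. N i \<subset> N (Suc i)"
      unfolding ideal_chain_def A_def by blast
    have "(\<forall>i\<le>n. f (N i) \<in> B) \<and> (\<forall>i<n. f (N i) \<subset> f (N (Suc i)))"
      using N f_strict bij unfolding bij_betw_def by (metis Suc_leI imageI less_imp_le)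
    then show "ideal_chain (R Quot I) {\<zero>\<^bsub>R Quot I\<^esub>} n"
      unfolding ideal_chain_def using zero unfolding B_def by (intro exI[of _ "\<lambda>i. f (N i)"]) blast
  qed
qed

lemma colength_eq:
  assumes "cring R" "ideal I R" "has_colength R I n"
  shows "colength R I = real n"
proof -
  interpret cring R by fact
  interpret Q: cring "R Quot I" using ideal.quotient_is_cring[OF assms(2,1)] .
  have "{n. \<exists>N. (\<forall>i\<le>n. submodule (N i) R (quotient_module R I)) \<and> (\<forall>i<n. N i \<subset> N (Suc i))} =
        {n. ideal_chain (R Quot I) {\<zero>\<^bsub>R Quot I\<^esub>} n}"
    unfolding ideal_chain_def submodule_quotient_module_iff[OF assms(1,2)]
    by (auto simp: additive_subgroup.zero_closed[OF ideal.axioms(1)])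
  also have "\<dots> = {n. ideal_chain R I n}" using ideal_chain_quotient[OF assms(2)] by simp
  finally have "module_length R (quotient_module R I) = (SUP n \<in> {n. ideal_chain R I n}. enat n)"
    unfolding module_length_def by simp
  also have "\<dots> = enat n"
    using assms(3) unfolding has_colength_def by (intro antisym SUP_least SUP_upper) auto
  finally show ?thesis unfolding colength_def by simp
qed

section \<open>Counting exponents\<close>

definition add_exp :: "nat list \<Rightarrow> nat list \<Rightarrow> nat list" where
  "add_exp b c = map2 (+) b c"

definition grlex_key :: "nat list \<Rightarrow> nat list" where
  "grlex_key b = sum_list b # b"

definition box :: "nat \<Rightarrow> nat \<Rightarrow> nat list set" where
  "box d q = {b. length b = d \<and> set b \<subseteq> {..<q}}"

definition simplex :: "nat \<Rightarrow> nat \<Rightarrow> nat list set" where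
  "simplex d n = {b. length b = d \<and> sum_list b < n}"

lemma length_add_exp [simp]: "length b = length c \<Longrightarrow> length (add_exp b c) = length c"
  by (simp add: add_exp_def)

lemma sum_list_add_exp: "length b = length c \<Longrightarrow> sum_list (add_exp b c) = sum_list b + sum_list c"
  unfolding add_exp_def by (induction b c rule: list_induct2) auto

lemma add_exp_less_mono:
  assumes "length a = length b" "length b = length c" "a < b"
  shows "add_exp a c < add_exp b c"
  using assms unfolding add_exp_def by (induction a b c rule: list_induct3) auto

lemma grlex_key_add_mono:
  assumes "length a = length b" "length b = length c" "grlex_key a < grlex_key b"
  shows "grlex_key (add_exp a c) < grlex_key (add_exp b c)"
  using assms add_exp_less_mono[of a b c] by (auto simp: grlex_key_def sum_list_add_exp)

lemma grlex_key_less_add: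
  assumes "length b = length c" "0 < sum_list c"
  shows "grlex_key b < grlex_key (add_exp b c)"
  using assms by (simp add: grlex_key_def sum_list_add_exp)

lemma list_all2_le_imp_add_exp:
  assumes "list_all2 (\<le>) a (b :: nat list)"
  obtains c where "length c = length a" "b = add_exp a c"
proof
  show "length (map2 (-) b a) = length a" using assms by (simp add: list_all2_lengthD)
  show "b = add_exp a (map2 (-) b a)"
    unfolding add_exp_def using assms by (induction rule: list_all2_induct) auto
qed

lemma finite_box: "finite (box d q)" and card_box: "card (box d q) = q ^ d"
proof -
  have eq: "box d q = {b. set b \<subseteq> {..<q} \<and> length b = d}" unfolding box_def by auto
  show "finite (box d q)" unfolding eq by (rule finite_lists_length_eq) simp
  show "card (box d q) = q ^ d" unfolding eq using card_lists_length_eq[of "{..<q}" d] by simp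
qed

lemma simplex_subset_box: "simplex d n \<subseteq> box d n"
  unfolding simplex_def box_def using member_le_sum_list by fastforce

lemma box_subset_simplex: "box d q \<subseteq> simplex d (d * q + 1)"
proof
  fix b assume b: "b \<in> box d q"
  then have "b ! k \<le> q" if "k < length b" for k
    using nth_mem[OF that] b unfolding box_def by (auto simp: less_imp_le)
  then have "sum_list b \<le> length b * q"
    unfolding sum_list_sum_nth using sum_bounded_above[of "{0..<length b}" "(!) b" q] by simp
  then show "b \<in> simplex d (d * q + 1)" using b by (simp add: box_def simplex_def)
qed

lemma finite_simplex: "finite (simplex d n)"
  using finite_subset[OF simplex_subset_box finite_box] .

lemma card_simplex_Suc: "card (simplex d (Suc n)) = (n + d) choose d"
proof -
  have "bij_betw (\<lambda>b. (n - sum_list b) # b) (simplex d (Suc n))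
          {l. length l = Suc d \<and> sum_list l = n}"
    by (rule bij_betw_byWitness[of _ tl]) (auto simp: simplex_def length_Suc_conv)
  then have "card (simplex d (Suc n)) = card {l :: nat list. length l = Suc d \<and> sum_list l = n}"
    by (rule bij_betw_same_card)
  also have "\<dots> = (n + d) choose n" using card_length_sum_list[of "Suc d" n] by simp
  also have "\<dots> = (n + d) choose d" using binomial_symmetric[of n "n + d"] by simp
  finally show ?thesis .
qed

lemma card_simplex_bounds:
  assumes "0 < n"
  shows "real n ^ d \<le> fact d * real (card (simplex d n))"
    and "fact d * real (card (simplex d n)) \<le> (real n + real d) ^ d"
proof -
  obtain m where m: "n = Suc m" using assms gr0_conv_Suc by blast
  have "fact d * ((m + d) choose d) = (\<Prod>i=0..<d. m + Suc i)"
  proof (induction d)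
    case (Suc d)
    have "fact (Suc d) * ((m + Suc d) choose Suc d) = fact d * (Suc (m + d) * ((m + d) choose d))"
      by (simp only: Suc_times_binomial_eq fact_Suc add_Suc_right of_nat_id mult_ac)
    also have "\<dots> = Suc (m + d) * (fact d * ((m + d) choose d))" by (simp only: mult_ac)
    finally show ?case unfolding Suc by (simp add: mult_ac)
  qed simp
  then have eq: "fact d * real (card (simplex d n)) = (\<Prod>i=0..<d. real (m + Suc i))"
    unfolding m card_simplex_Suc by (metis of_nat_fact of_nat_mult of_nat_prod)
  have "(\<Prod>i=0..<d. real n) \<le> (\<Prod>i=0..<d. real (m + Suc i))"
    by (rule prod_mono) (auto simp: m)
  then show "real n ^ d \<le> fact d * real (card (simplex d n))" unfolding eq by simp
  have "(\<Prod>i=0..<d. real (m + Suc i)) \<le> (\<Prod>i=0..<d. real n + real d)"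
    by (rule prod_mono) (auto simp: m)
  then show "fact d * real (card (simplex d n)) \<le> (real n + real d) ^ d" unfolding eq by simp
qed

lemma card_simplex_limit:
  "(\<lambda>n. fact d * real (card (simplex d n)) / real n ^ d) \<longlonglongrightarrow> 1"
proof (rule tendsto_sandwich[where f = "\<lambda>_. 1" and h = "\<lambda>n. (1 + real d / real n) ^ d"])
  have "(\<lambda>n. (1 + real d / real n) ^ d) \<longlonglongrightarrow> (1 + 0) ^ d"
    by (intro tendsto_intros lim_const_over_n)
  then show "(\<lambda>n. (1 + real d / real n) ^ d) \<longlonglongrightarrow> 1" by simp
  show "\<forall>\<^sub>F n in sequentially. fact d * real (card (simplex d n)) / real n ^ d \<le> (1 + real d / real n) ^ d"
    using eventually_gt_at_top[of 0]
  proof eventually_elim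
    case (elim n)
    have "(1 + real d / real n) ^ d = (real n + real d) ^ d / real n ^ d"
      using elim by (simp add: add_divide_distrib flip: power_divide)
    then show ?case using card_simplex_bounds(2)[OF elim, of d] by (simp add: divide_right_mono)
  qed
  show "\<forall>\<^sub>F n in sequentially. 1 \<le> fact d * real (card (simplex d n)) / real n ^ d"
    using eventually_gt_at_top[of 0]
  proof eventually_elim
    case (elim n)
    then show ?case using card_simplex_bounds(1)[OF elim, of d] by (simp add: le_divide_eq)
  qed
qed (rule tendsto_const)

lemma card_box_slab:
  assumes "k < d" "0 < q"
  shows "real (card {b \<in> box d q. b ! k < a}) \<le> real a * real q ^ d / real q"
proof -
  define f where "f = (\<lambda>(v, l :: nat list). take k l @ v # drop k l)"
  have "{b \<in> box d q. b ! k < a} \<subseteq> f ` ({..<a} \<times> box (d - 1) q)"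
  proof
    fix b assume b: "b \<in> {b \<in> box d q. b ! k < a}"
    then have len: "length b = d" unfolding box_def by simp
    have "b = f (b ! k, take k b @ drop (Suc k) b)"
      unfolding f_def using assms len by (simp add: id_take_nth_drop[symmetric])
    moreover have "take k b @ drop (Suc k) b \<in> box (d - 1) q"
      using b assms set_take_subset[of k b] set_drop_subset[of "Suc k" b] unfolding box_def by auto
    ultimately show "b \<in> f ` ({..<a} \<times> box (d - 1) q)" using b by blast
  qed
  then have "card {b \<in> box d q. b ! k < a} \<le> card ({..<a} \<times> box (d - 1) q)"
    using finite_box by (meson card_image_le card_mono finite_SigmaI finite_imageI finite_lessThan order_trans)
  then have "real (card {b \<in> box d q. b ! k < a}) \<le> real (a * q ^ (d - 1))"
    unfolding card_cartesian_product card_box card_lessThan of_nat_le_iff .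
  moreover have "real q ^ d = real q ^ (d - 1) * real q" using assms by (simp flip: power_Suc2)
  ultimately show ?thesis using assms by simp
qed

lemma card_box_not_above:
  assumes "length a = d" "0 < q"
  shows "real (card {b \<in> box d q. \<not> list_all2 (\<le>) a b}) \<le> real (sum_list a) * real q ^ d / real q"
proof -
  have "{b \<in> box d q. \<not> list_all2 (\<le>) a b} \<subseteq> (\<Union>k\<in>{..<d}. {b \<in> box d q. b ! k < a ! k})"
    using assms(1) by (auto simp: list_all2_conv_all_nth box_def not_le)
  then have "card {b \<in> box d q. \<not> list_all2 (\<le>) a b}
      \<le> card (\<Union>k\<in>{..<d}. {b \<in> box d q. b ! k < a ! k})"
    by (intro card_mono) (auto simp: finite_box)
  also have "\<dots> \<le> (\<Sum>k<d. card {b \<in> box d q. b ! k < a ! k})" by (rule card_UN_le) simp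
  finally have "real (card {b \<in> box d q. \<not> list_all2 (\<le>) a b})
      \<le> (\<Sum>k<d. real (card {b \<in> box d q. b ! k < a ! k}))" by (simp flip: of_nat_sum)
  also have "\<dots> \<le> (\<Sum>k<d. real (a ! k) * real q ^ d / real q)"
    by (intro sum_mono card_box_slab) (use assms in auto)
  also have "\<dots> = real (\<Sum>k<d. a ! k) * real q ^ d / real q"
    by (simp add: sum_divide_distrib sum_distrib_right)
  also have "(\<Sum>k<d. a ! k) = sum_list a" using assms(1) by (simp add: sum_list_sum_nth atLeast0LessThan)
  finally show ?thesis .
qed

lemma card_avoiding_upset:
  assumes T: "\<And>a b. T a \<Longrightarrow> length a = d \<Longrightarrow> list_all2 (\<le>) a b \<Longrightarrow> T b"
  shows "\<exists>C\<ge>0. \<forall>q>0. (\<exists>a. length a = d \<and> T a) \<longrightarrow>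
    real (card {b \<in> box d q. \<not> T b}) \<le> C * real q ^ d / real q"
proof (cases "\<exists>a. length a = d \<and> T a")
  case True
  then obtain a where a: "length a = d" "T a" by blast
  have "real (card {b \<in> box d q. \<not> T b}) \<le> real (sum_list a) * real q ^ d / real q" if "0 < q" for q
  proof -
    have "card {b \<in> box d q. \<not> T b} \<le> card {b \<in> box d q. \<not> list_all2 (\<le>) a b}"
      by (intro card_mono) (use T a in \<open>auto simp: finite_box\<close>)
    then show ?thesis using card_box_not_above[OF a(1) that] by linarith
  qed
  then show ?thesis by (intro exI[of _ "real (sum_list a)"]) auto
qed auto

section \<open>Monomials and the filtration they define\<close>

fun monom_at :: "('a, 'b) ring_scheme \<Rightarrow> 'a list \<Rightarrow> nat list \<Rightarrow> 'a" where
  "monom_at R (x # xs) (b # bs) = (x [^]\<^bsub>R\<^esub> b) \<otimes>\<^bsub>R\<^esub> monom_at R xs bs"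
| "monom_at R _ _ = \<one>\<^bsub>R\<^esub>"

definition grlex_above :: "nat list \<Rightarrow> nat list set" where
  "grlex_above b = {c. length c = length b \<and> grlex_key b < grlex_key c}"

context cring
begin

lemma monom_at_closed [simp]: "set xs \<subseteq> carrier R \<Longrightarrow> monom_at R xs b \<in> carrier R"
proof (induction xs arbitrary: b)
  case (Cons x xs)
  then show ?case by (cases b) auto
qed simp

lemma monom_at_replicate_0: "set xs \<subseteq> carrier R \<Longrightarrow> monom_at R xs (replicate (length xs) 0) = \<one>"
  by (induction xs) auto

lemma monom_at_add_exp:
  assumes "length b = length xs" "length c = length xs" "set xs \<subseteq> carrier R"
  shows "monom_at R xs (add_exp b c) = monom_at R xs b \<otimes> monom_at R xs c"
proof -
  have "length b = length c" "length c = length xs" using assms by auto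
  then show ?thesis using assms(3) unfolding add_exp_def
  proof (induction b c xs rule: list_induct3)
    case (Cons b bs c cs x xs)
    have "x [^] b \<otimes> x [^] c \<otimes> (monom_at R xs bs \<otimes> monom_at R xs cs) =
      x [^] b \<otimes> monom_at R xs bs \<otimes> (x [^] c \<otimes> monom_at R xs cs)"
      using Cons.prems by (simp add: m_ac)
    then show ?case using Cons by (simp add: nat_pow_mult)
  qed simp
qed

lemma monom_at_unit:
  assumes "k < length xs" "set xs \<subseteq> carrier R"
  shows "monom_at R xs ((replicate (length xs) 0)[k := 1]) = xs ! k"
  using assms
proof (induction xs arbitrary: k)
  case (Cons x xs)
  then show ?case
    by (cases k) (auto simp: monom_at_replicate_0 subset_iff)
qed simp

lemma monom_at_pow:
  assumes "length b = length xs" "set xs \<subseteq> carrier R"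
  shows "monom_at R xs (map ((*) q) b) = monom_at R xs b [^] q"
    and "monom_at R (map (\<lambda>x. x [^] q) xs) b = monom_at R xs (map ((*) q) b)"
  using assms
  by (induction b xs rule: list_induct2) (auto simp: nat_pow_pow nat_pow_distrib mult.commute)

lemma Idl_mult_right:
  assumes "A \<subseteq> carrier R" "ideal K R" "u \<in> carrier R"
    and "\<And>a. a \<in> A \<Longrightarrow> a \<otimes> u \<in> K" and "x \<in> Idl A"
  shows "x \<otimes> u \<in> K"
proof -
  interpret K: ideal K R by fact
  have "ideal {r \<in> carrier R. r \<otimes> u \<in> K} R"
  proof (rule idealI[OF ring_axioms])
    show "subgroup {r \<in> carrier R. r \<otimes> u \<in> K} (add_monoid R)"
      by (rule subgroup.intro) (use assms(3) in \<open>auto simp: l_distr l_minus simp flip: a_inv_def\<close>)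
  next
    fix a y assume a: "a \<in> {r \<in> carrier R. r \<otimes> u \<in> K}" and y: "y \<in> carrier R"
    then have eq: "y \<otimes> a \<otimes> u = y \<otimes> (a \<otimes> u)" using assms(3) by (simp add: m_assoc)
    then show "y \<otimes> a \<in> {r \<in> carrier R. r \<otimes> u \<in> K}" using a y K.I_l_closed by auto
    then show "a \<otimes> y \<in> {r \<in> carrier R. r \<otimes> u \<in> K}" using a y by (simp add: m_comm)
  qed
  then have "Idl A \<subseteq> {r \<in> carrier R. r \<otimes> u \<in> K}"
    by (rule genideal_minimal) (use assms in auto)
  then show ?thesis using assms(5) by blast
qed

lemma Idl_mult:
  assumes "A \<subseteq> carrier R" "B \<subseteq> carrier R" "ideal K R"
    and ab: "\<And>a b. a \<in> A \<Longrightarrow> b \<in> B \<Longrightarrow> a \<otimes> b \<in> K" and "x \<in> Idl A" "y \<in> Idl B"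
  shows "x \<otimes> y \<in> K"
proof -
  have x: "x \<in> carrier R" using ideal_subset[OF genideal_ideal[OF assms(1)]] assms(5) by blast
  have y: "y \<in> carrier R" using ideal_subset[OF genideal_ideal[OF assms(2)]] assms(6) by blast
  have "y \<otimes> x \<in> K"
  proof (rule Idl_mult_right[OF assms(2,3) x _ assms(6)])
    fix b assume b: "b \<in> B"
    have "x \<otimes> b \<in> K"
      by (rule Idl_mult_right[OF assms(1,3) _ _ assms(5)]) (use ab b assms(2) in auto)
    then show "b \<otimes> x \<in> K" using b x assms(2) m_comm by (metis subsetD)
  qed
  then show ?thesis using x y by (simp add: m_comm)
qed

lemma Idl_insert_Idl:
  assumes "A \<subseteq> carrier R" "u \<in> carrier R"
  shows "Idl (insert u (Idl A)) = Idl (insert u A)"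
proof
  have A: "ideal (Idl A) R" "A \<subseteq> Idl A" using assms genideal_ideal genideal_self by auto
  have sub: "insert u A \<subseteq> carrier R" "insert u (Idl A) \<subseteq> carrier R"
    using assms ideal_subset[OF A(1)] by auto
  show "Idl (insert u (Idl A)) \<subseteq> Idl (insert u A)"
    using subset_Idl_subset[OF sub(1), of A] genideal_self[OF sub(1)]
    by (intro genideal_minimal genideal_ideal sub) auto
  show "Idl (insert u A) \<subseteq> Idl (insert u (Idl A))"
    using A by (intro subset_Idl_subset sub) auto
qed

lemma has_colength_filtration:
  assumes "maximalideal \<mm> R" "A \<subseteq> carrier R" "set us \<subseteq> carrier R"
    and "\<And>i r. i < length us \<Longrightarrow> r \<in> \<mm> \<Longrightarrow> r \<otimes> us ! i \<in> Idl (A \<union> set (take i us))"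
    and "has_colength R (Idl (A \<union> set us)) n"
  shows "has_colength R (Idl A) (n + card {i. i < length us \<and> us ! i \<notin> Idl (A \<union> set (take i us))})"
  using assms(3-)
proof (induction us arbitrary: n rule: rev_induct)
  case (snoc u us)
  let ?F = "Idl (A \<union> set us)"
  let ?I = "{i. i < length us \<and> us ! i \<notin> Idl (A \<union> set (take i us))}"
  have sub: "A \<union> set us \<subseteq> carrier R" and u: "u \<in> carrier R" using assms(2) snoc.prems by auto
  have "r \<otimes> u \<in> ?F" if "r \<in> \<mm>" for r
    using snoc.prems(2)[of "length us" r] that by simp
  moreover have "has_colength R (Idl (insert u ?F)) n"
    using snoc.prems(3) Idl_insert_Idl[OF sub u] by (simp add: insert_commute)
  ultimately have "has_colength R ?F (n + (if u \<in> ?F then 0 else 1))"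
    using has_colength_insert[OF assms(1) genideal_ideal[OF sub] u] by blast
  moreover have "r \<otimes> us ! i \<in> Idl (A \<union> set (take i us))" if "i < length us" "r \<in> \<mm>" for i r
    using snoc.prems(2)[of i r] that by (simp add: nth_append)
  ultimately have "has_colength R (Idl A) (n + (if u \<in> ?F then 0 else 1) + card ?I)"
    using snoc.IH snoc.prems(1) by simp
  moreover have "{i. i < length (us @ [u]) \<and> (us @ [u]) ! i \<notin> Idl (A \<union> set (take i (us @ [u])))}
      = ?I \<union> (if u \<in> ?F then {} else {length us})"
    by (auto simp: nth_append less_Suc_eq)
  moreover have "card (?I \<union> (if u \<in> ?F then {} else {length us})) = card ?I + (if u \<in> ?F then 0 else 1)"
    by simp
  ultimately show ?case by (simp add: add_ac)
qed simp

lemma Idl_power_eq_monomials: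
  assumes xs: "set xs \<subseteq> carrier R"
  shows "(Idl (set xs)) [^]\<^bsub>ideals_set R\<^esub> n =
    Idl (monom_at R xs ` ({b. length b = length xs} - simplex (length xs) n))"
    (is "_ = Idl (?M n)")
proof (induction n)
  have M: "?M n \<subseteq> carrier R" for n using xs by auto
  {
    case 0
    have "\<one> \<in> ?M 0"
      using monom_at_replicate_0[OF xs] by (intro image_eqI[of _ _ "replicate (length xs) 0"]) (auto simp: simplex_def)
    then have "\<one> \<in> Idl (?M 0)" using genideal_self[OF M] by blast
    then have "Idl (?M 0) = carrier R" using ideal.one_imp_carrier[OF genideal_ideal[OF M]] by blast
    then show ?case by (simp add: ideals_set_def)
  next
    case (Suc n)
    have J: "ideal (Idl (set xs)) R" and Mn: "ideal (Idl (?M n)) R" "ideal (Idl (?M (Suc n))) R"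
      using xs M genideal_ideal by blast+
    have "(Idl (set xs)) [^]\<^bsub>ideals_set R\<^esub> (Suc n) = (Idl (?M n)) \<cdot> (Idl (set xs))"
      using Suc by (simp add: ideals_set_def)
    also have "\<dots> = Idl (?M (Suc n))"
    proof
      show "(Idl (?M n)) \<cdot> (Idl (set xs)) \<subseteq> Idl (?M (Suc n))"
      proof
        fix s assume "s \<in> (Idl (?M n)) \<cdot> (Idl (set xs))"
        then show "s \<in> Idl (?M (Suc n))"
        proof induction
          case (prod i j)
          show ?case
          proof (rule Idl_mult[OF M xs Mn(2) _ prod])
            fix a x assume a: "a \<in> ?M n" and x: "x \<in> set xs"
            obtain k where k: "k < length xs" "x = xs ! k" using x by (metis in_set_conv_nth)
            obtain b where b: "length b = length xs" "n \<le> sum_list b" "a = monom_at R xs b"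
              using a unfolding simplex_def by (auto simp flip: not_less)
            let ?e = "(replicate (length xs) (0 :: nat))[k := 1]"
            have "a \<otimes> x = monom_at R xs (add_exp b ?e)"
              using monom_at_add_exp[OF b(1) _ xs, of ?e] monom_at_unit[OF k(1) xs] b k by simp
            moreover have "add_exp b ?e \<in> {b. length b = length xs} - simplex (length xs) (Suc n)"
              using b k by (simp add: simplex_def sum_list_add_exp sum_list_update)
            ultimately show "a \<otimes> x \<in> Idl (?M (Suc n))" using genideal_self[OF M] by blast
          qed
        next
          case (sum s1 s2)
          then show ?case using additive_subgroup.a_closed[OF ideal.axioms(1)[OF Mn(2)]] by blast
        qed
      qed
      show "Idl (?M (Suc n)) \<subseteq> (Idl (?M n)) \<cdot> (Idl (set xs))"
      proof (intro genideal_minimal[OF ideal_prod_is_ideal[OF Mn(1) J]] subsetI)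
        fix a assume "a \<in> ?M (Suc n)"
        then obtain b where a: "a = monom_at R xs b" and b: "length b = length xs" "\<not> sum_list b < Suc n"
          unfolding simplex_def by blast
        then have "sum_list b \<noteq> 0" by linarith
        then obtain k where k: "k < length xs" "b ! k \<noteq> 0"
          using b(1) by (metis in_set_conv_nth sum_list_eq_0_iff)
        let ?e = "(replicate (length xs) (0 :: nat))[k := 1]"
        have "list_all2 (\<le>) ?e b"
          using k b(1) by (auto simp: list_all2_conv_all_nth nth_list_update)
        then obtain c where c: "length c = length ?e" "b = add_exp ?e c"
          by (rule list_all2_le_imp_add_exp)
        have "sum_list b = 1 + sum_list c" using c k by (simp add: sum_list_add_exp sum_list_update)
        then have "monom_at R xs c \<in> Idl (?M n)"
          using b c(1) genideal_self[OF M[of n]] by (auto simp: simplex_def)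
        moreover have "xs ! k \<in> Idl (set xs)" using k genideal_self[OF xs] by auto
        moreover have "monom_at R xs b = monom_at R xs c \<otimes> xs ! k"
          using monom_at_add_exp[of ?e xs c] monom_at_unit[OF k(1) xs] c k xs
          by (simp add: m_comm subset_iff)
        ultimately show "a \<in> (Idl (?M n)) \<cdot> (Idl (set xs))"
          unfolding a using ideal_prod.prod by metis
      qed
    qed
    finally show ?case .
  }
qed

lemma monom_at_outside_box:
  assumes xs: "set xs \<subseteq> carrier R" and b: "length b = length xs" "b \<notin> box (length xs) q"
  shows "monom_at R xs b \<in> Idl (set (map (\<lambda>x. x [^] q) xs))"
proof -
  let ?P = "set (map (\<lambda>x. x [^] q) xs)"
  have P: "?P \<subseteq> carrier R" using xs by auto
  obtain k where k: "k < length xs" "q \<le> b ! k"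
    using b by (auto simp: box_def in_set_conv_nth not_less subset_iff)
  let ?e = "(replicate (length xs) (0 :: nat))[k := 1]"
  have "list_all2 (\<le>) (map ((*) q) ?e) b"
    using k b(1) by (auto simp: list_all2_conv_all_nth nth_list_update)
  then obtain c where c: "length c = length (map ((*) q) ?e)" "b = add_exp (map ((*) q) ?e) c"
    by (rule list_all2_le_imp_add_exp)
  have "monom_at R xs b = (xs ! k) [^] q \<otimes> monom_at R xs c"
    using monom_at_add_exp[of "map ((*) q) ?e" xs c] monom_at_pow(1)[of ?e xs q]
      monom_at_unit[OF k(1) xs] c k xs by simp
  moreover have "(xs ! k) [^] q \<in> Idl ?P" using k genideal_self[OF P] by auto
  ultimately show ?thesis
    using ideal.I_r_closed[OF genideal_ideal[OF P]] xs by simp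
qed

lemma Idl_power_subset_power_list:
  assumes xs: "set xs \<subseteq> carrier R"
  shows "(Idl (set xs)) [^]\<^bsub>ideals_set R\<^esub> (length xs * q + 1) \<subseteq> Idl (set (map (\<lambda>x. x [^] q) xs))"
  unfolding Idl_power_eq_monomials[OF xs]
proof (intro genideal_minimal genideal_ideal subsetI)
  fix a assume "a \<in> monom_at R xs ` ({b. length b = length xs} - simplex (length xs) (length xs * q + 1))"
  then obtain b where b: "length b = length xs" "b \<notin> simplex (length xs) (length xs * q + 1)"
    "a = monom_at R xs b" by blast
  then show "a \<in> Idl (set (map (\<lambda>x. x [^] q) xs))"
    using monom_at_outside_box[OF xs b(1)] box_subset_simplex by blast
qed (use xs in auto)

end

locale parameter_filtration = cring R for R (structure) +
  fixes \<mm> :: "'a set" and xs us :: "'a list"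
  assumes maximal: "maximalideal \<mm> R"
    and xs: "set xs \<subseteq> carrier R"
    and us: "set us \<subseteq> carrier R"
    and us_step: "\<And>i r. i < length us \<Longrightarrow> r \<in> \<mm> \<Longrightarrow> r \<otimes> us ! i \<in> Idl (set xs \<union> set (take i us))"
    and us_full: "Idl (set xs \<union> set us) = carrier R"
begin

abbreviation "nvars \<equiv> length xs"
abbreviation "exps \<equiv> {b :: nat list. length b = length xs}"
abbreviation "xpow \<equiv> monom_at R xs"

definition lower_part :: "nat list \<Rightarrow> nat \<Rightarrow> 'a set" where
  "lower_part b i = xpow ` grlex_above b \<union> (\<lambda>u. u \<otimes> xpow b) ` set (take i us)"

definition redundant :: "nat \<Rightarrow> nat list \<Rightarrow> bool" where
  "redundant i b \<longleftrightarrow> us ! i \<otimes> xpow b \<in> Idl (lower_part b i)"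

definition weight :: "nat list \<Rightarrow> nat" where
  "weight b = card {i. i < length us \<and> \<not> redundant i b}"

lemma take_us: "set (take i us) \<subseteq> carrier R"
  using us set_take_subset[of i us] by auto

lemma lower_part_closed: "lower_part b i \<subseteq> carrier R"
  unfolding lower_part_def using xs take_us[of i] by auto

lemma mult_mon_lower_part:
  assumes "length b = nvars" "y \<in> Idl (set xs \<union> set (take i us))"
  shows "y \<otimes> xpow b \<in> Idl (lower_part b i)"
proof (rule Idl_mult_right[OF _ _ _ _ assms(2)])
  fix a assume "a \<in> set xs \<union> set (take i us)"
  then show "a \<otimes> xpow b \<in> Idl (lower_part b i)"
  proof
    assume "a \<in> set (take i us)"
    then show ?thesis using genideal_self[OF lower_part_closed] unfolding lower_part_def by blast
  next
    assume "a \<in> set xs"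
    then obtain k where k: "k < nvars" "a = xs ! k" by (metis in_set_conv_nth)
    let ?e = "(replicate nvars (0 :: nat))[k := 1]"
    have "a \<otimes> xpow b = xpow (add_exp b ?e)"
      using monom_at_add_exp[OF assms(1) _ xs, of ?e] monom_at_unit[OF k(1) xs] k xs
      by (simp add: m_comm subset_iff)
    moreover have "add_exp b ?e \<in> grlex_above b"
      using assms(1) k grlex_key_less_add[of b ?e] unfolding grlex_above_def
      by (simp add: sum_list_update)
    ultimately show ?thesis
      using genideal_self[OF lower_part_closed] unfolding lower_part_def by blast
  qed
qed (use xs take_us genideal_ideal lower_part_closed in auto)

lemma redundant_mono:
  assumes "i < length us" "redundant i a" "length a = nvars" "list_all2 (\<le>) a b"
  shows "redundant i b"
proof -
  obtain c where c: "length c = length a" "b = add_exp a c"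
    using list_all2_le_imp_add_exp[OF assms(4)] .
  have b: "length b = nvars" and mb: "xpow b = xpow a \<otimes> xpow c"
    using c assms(3) monom_at_add_exp[of a xs c] xs by auto
  have in_lower: "y \<in> Idl (lower_part b i)" if "y \<in> lower_part b i" for y
    using that genideal_self[OF lower_part_closed] by blast
  have "(us ! i \<otimes> xpow a) \<otimes> xpow c \<in> Idl (lower_part b i)"
  proof (rule Idl_mult_right[OF lower_part_closed[of a i] genideal_ideal[OF lower_part_closed]])
    show "us ! i \<otimes> xpow a \<in> Idl (lower_part a i)" using assms(2) unfolding redundant_def .
    fix y assume "y \<in> lower_part a i"
    then consider e where "e \<in> grlex_above a" "y = xpow e" | u where "u \<in> set (take i us)" "y = u \<otimes> xpow a"
      unfolding lower_part_def by blast
    then show "y \<otimes> xpow c \<in> Idl (lower_part b i)"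
    proof cases
      case 1
      then have "length e = nvars" "grlex_key (add_exp a c) < grlex_key (add_exp e c)"
        using assms(3) c grlex_key_add_mono[of a e c] unfolding grlex_above_def by auto
      then have "add_exp e c \<in> grlex_above b" "y \<otimes> xpow c = xpow (add_exp e c)"
        using 1 c b assms(3) monom_at_add_exp[of e xs c] xs unfolding grlex_above_def by auto
      then show ?thesis by (intro in_lower) (auto simp: lower_part_def)
    next
      case 2
      then have "u \<in> carrier R" using take_us by blast
      then have "y \<otimes> xpow c = u \<otimes> xpow b" using 2 mb xs by (simp add: m_assoc)
      then show ?thesis using 2 by (intro in_lower) (auto simp: lower_part_def)
    qed
  qed (use xs in auto)
  moreover have "us ! i \<otimes> xpow a \<otimes> xpow c = us ! i \<otimes> xpow b"
    using mb xs us assms(1) by (simp add: m_assoc subset_iff)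
  ultimately show ?thesis unfolding redundant_def by metis
qed

lemma has_colength_monomial_step:
  assumes K: "K \<subseteq> carrier R" and b: "length b = nvars"
    and len: "has_colength R (Idl (K \<union> xpow ` insert b (grlex_above b))) n"
  shows "has_colength R (Idl (K \<union> xpow ` grlex_above b))
    (n + card {i. i < length us \<and> us ! i \<otimes> xpow b \<notin> Idl (K \<union> lower_part b i)})"
proof -
  let ?A = "K \<union> xpow ` grlex_above b"
  define vs where "vs = map (\<lambda>u. u \<otimes> xpow b) us"
  have A: "?A \<subseteq> carrier R" using K xs by auto
  have vs: "set vs \<subseteq> carrier R" unfolding vs_def using us xs by auto
  have eq: "?A \<union> set (take i vs) = K \<union> lower_part b i" for i
    unfolding lower_part_def vs_def by (auto simp: take_map)
  have KL: "K \<union> lower_part b i \<subseteq> carrier R" for i using K lower_part_closed by auto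
  have sub: "Idl (lower_part b i) \<subseteq> Idl (K \<union> lower_part b i)" for i
    by (rule subset_Idl_subset[OF KL]) simp
  have "Idl (?A \<union> set vs) = Idl (K \<union> xpow ` insert b (grlex_above b))"
  proof
    have sub': "K \<union> xpow ` insert b (grlex_above b) \<subseteq> carrier R" using K xs by auto
    have id': "ideal (Idl (K \<union> xpow ` insert b (grlex_above b))) R" using genideal_ideal[OF sub'] .
    have "xpow b \<in> Idl (K \<union> xpow ` insert b (grlex_above b))" using genideal_self[OF sub'] by blast
    then have "u \<otimes> xpow b \<in> Idl (K \<union> xpow ` insert b (grlex_above b))" if "u \<in> set us" for u
      using that us ideal.I_l_closed[OF id'] by blast
    then show "Idl (?A \<union> set vs) \<subseteq> Idl (K \<union> xpow ` insert b (grlex_above b))"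
      using genideal_self[OF sub'] unfolding vs_def by (intro genideal_minimal[OF id']) auto
    have "\<one> \<otimes> xpow b \<in> Idl (lower_part b (length us))"
      using mult_mon_lower_part[OF b, of \<one> "length us"] us_full by simp
    then have "xpow b \<in> Idl (K \<union> lower_part b (length vs))" using sub xs unfolding vs_def by auto
    moreover have "?A \<union> set vs = K \<union> lower_part b (length vs)" using eq[of "length vs"] by simp
    ultimately have xb: "xpow b \<in> Idl (?A \<union> set vs)" by simp
    have AV: "?A \<union> set vs \<subseteq> carrier R" using A vs by blast
    have "K \<union> xpow ` insert b (grlex_above b) \<subseteq> Idl (?A \<union> set vs)"
      using xb genideal_self[OF AV] by blast
    then show "Idl (K \<union> xpow ` insert b (grlex_above b)) \<subseteq> Idl (?A \<union> set vs)"
      by (rule genideal_minimal[OF genideal_ideal[OF AV]])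
  qed
  then have "has_colength R (Idl (?A \<union> set vs)) n" using len by simp
  moreover have "r \<otimes> vs ! i \<in> Idl (?A \<union> set (take i vs))" if i: "i < length vs" "r \<in> \<mm>" for i r
  proof -
    have "r \<in> carrier R" using i(2) ideal_subset[OF maximalideal.axioms(1)[OF maximal]] by blast
    then have "r \<otimes> vs ! i = (r \<otimes> us ! i) \<otimes> xpow b"
      using i us xs unfolding vs_def by (simp add: m_assoc subset_iff)
    then show ?thesis
      using mult_mon_lower_part[OF b us_step[of i r]] i sub[of i] unfolding eq by (auto simp: vs_def)
  qed
  ultimately have "has_colength R (Idl ?A)
      (n + card {i. i < length vs \<and> vs ! i \<notin> Idl (?A \<union> set (take i vs))})"
    using has_colength_filtration[OF maximal A vs] by blast
  moreover have "{i. i < length vs \<and> vs ! i \<notin> Idl (?A \<union> set (take i vs))} =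
      {i. i < length us \<and> us ! i \<otimes> xpow b \<notin> Idl (K \<union> lower_part b i)}"
    unfolding eq by (auto simp: vs_def)
  ultimately show ?thesis by simp
qed

lemma has_colength_monomials:
  assumes K: "K \<subseteq> carrier R" and "finite D" "D \<subseteq> exps"
    and "\<And>b c. b \<in> D \<Longrightarrow> length c = nvars \<Longrightarrow> grlex_key c < grlex_key b \<Longrightarrow> c \<in> D"
  shows "\<exists>N. has_colength R (Idl (K \<union> xpow ` (exps - D))) N \<and>
    N \<le> (\<Sum>b\<in>{b \<in> D. xpow b \<notin> K}. weight b) \<and> (K = {} \<longrightarrow> N = (\<Sum>b\<in>D. weight b))"
  using assms(2-)
proof (induction "card D" arbitrary: D)
  case 0
  have sub: "K \<union> xpow ` exps \<subseteq> carrier R" using K xs by auto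
  have "\<one> \<in> xpow ` exps" using monom_at_replicate_0[OF xs] by (metis (mono_tags) imageI length_replicate mem_Collect_eq)
  then have "\<one> \<in> Idl (K \<union> xpow ` exps)" using genideal_self[OF sub] by blast
  then have "Idl (K \<union> xpow ` exps) = carrier R"
    using ideal.one_imp_carrier[OF genideal_ideal[OF sub]] by blast
  then show ?case using 0 has_colength_carrier by auto
next
  case (Suc m)
  have "D \<noteq> {}" using Suc.hyps(2) by auto
  have "finite (grlex_key ` D)" "grlex_key ` D \<noteq> {}" using Suc.prems(1) \<open>D \<noteq> {}\<close> by auto
  then obtain b where b: "b \<in> D" "grlex_key b = Max (grlex_key ` D)"
    using Max_in by (metis imageE)
  then have max: "grlex_key c \<le> grlex_key b" if "c \<in> D" for c
    using that Suc.prems(1) by simp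
  have inj: "grlex_key c = grlex_key b \<longleftrightarrow> c = b" for c by (auto simp: grlex_key_def)
  have lb: "length b = nvars" using b Suc.prems(2) by auto
  define D' where "D' = D - {b}"
  have D': "D = insert b D'" "b \<notin> D'" "finite D'" using b Suc.prems(1) unfolding D'_def by auto
  have above: "exps - D = grlex_above b"
    using max Suc.prems(3)[OF b(1)] b(1) inj lb unfolding grlex_above_def
    by (auto simp flip: not_less) (metis linorder_neqE not_less)
  then have above': "exps - D' = insert b (grlex_above b)" using b lb unfolding D'_def by auto
  have "c \<in> D'" if "a \<in> D'" "length c = nvars" "grlex_key c < grlex_key a" for a c
    using that Suc.prems(3)[of a c] max[of a] unfolding D'_def by auto
  moreover have "m = card D'" using Suc.hyps(2) D' by simp
  ultimately obtain N where N: "has_colength R (Idl (K \<union> xpow ` (exps - D'))) N"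
      "N \<le> (\<Sum>b\<in>{b \<in> D'. xpow b \<notin> K}. weight b)" "K = {} \<longrightarrow> N = (\<Sum>b\<in>D'. weight b)"
    using Suc.hyps(1)[of D'] D' Suc.prems(2) by auto
  define w where "w = card {i. i < length us \<and> us ! i \<otimes> xpow b \<notin> Idl (K \<union> lower_part b i)}"
  have KL: "K \<union> lower_part b i \<subseteq> carrier R" for i using K lower_part_closed by auto
  have len: "has_colength R (Idl (K \<union> xpow ` (exps - D))) (N + w)"
    using has_colength_monomial_step[OF K lb] N(1) unfolding above above' w_def by blast
  have "w \<le> weight b"
    unfolding w_def weight_def redundant_def
    using subset_Idl_subset[OF KL, of "lower_part b _"] by (intro card_mono) auto
  moreover have "w = 0" if "xpow b \<in> K"
  proof -
    have "xpow b \<in> Idl (K \<union> lower_part b i)" for i using that genideal_self[OF KL] by blast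
    then have "us ! i \<otimes> xpow b \<in> Idl (K \<union> lower_part b i)" if "i < length us" for i
      using that us ideal.I_l_closed[OF genideal_ideal[OF KL]] by (simp add: subset_iff)
    then show ?thesis unfolding w_def by simp
  qed
  moreover have "w = weight b" if "K = {}"
    unfolding w_def weight_def redundant_def that by simp
  moreover have "{b' \<in> D. xpow b' \<notin> K} =
      (if xpow b \<in> K then {b' \<in> D'. xpow b' \<notin> K} else insert b {b' \<in> D'. xpow b' \<notin> K})"
    unfolding D'(1) by auto
  ultimately have "N + w \<le> (\<Sum>b\<in>{b \<in> D. xpow b \<notin> K}. weight b)" "K = {} \<longrightarrow> N + w = (\<Sum>b\<in>D. weight b)"
    using N D' by auto
  then show ?case using len by blast
qed

lemma has_colength_power:
  "has_colength R ((Idl (set xs)) [^]\<^bsub>ideals_set R\<^esub> n) (\<Sum>b\<in>simplex nvars n. weight b)"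
proof -
  have "\<exists>N. has_colength R (Idl ({} \<union> xpow ` (exps - simplex nvars n))) N \<and>
    N \<le> (\<Sum>b\<in>{b \<in> simplex nvars n. xpow b \<notin> {}}. weight b) \<and>
    (({} :: 'a set) = {} \<longrightarrow> N = (\<Sum>b\<in>simplex nvars n. weight b))"
    by (rule has_colength_monomials) (auto simp: finite_simplex, auto simp: simplex_def grlex_key_def)
  then show ?thesis unfolding Idl_power_eq_monomials[OF xs] by auto
qed

lemma has_colength_power_list:
  assumes "0 < q"
  shows "\<exists>N. has_colength R (Idl (set (map (\<lambda>x. x [^] q) xs))) N \<and> N \<le> (\<Sum>b\<in>box nvars q. weight b)"
proof -
  let ?P = "set (map (\<lambda>x. x [^] q) xs)"
  define K where "K = ?P \<union> xpow ` (exps - box nvars q)"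
  define n where "n = nvars * q + 1"
  have P: "?P \<subseteq> carrier R" using xs by auto
  then have K: "K \<subseteq> carrier R" unfolding K_def using xs by auto
  have "box nvars q \<subseteq> simplex nvars n" unfolding n_def by (rule box_subset_simplex)
  then have sub: "exps - simplex nvars n \<subseteq> exps - box nvars q" by blast
  have "xpow b \<in> Idl ?P" if "length b = nvars" "b \<notin> box nvars q" for b
    using monom_at_outside_box[OF xs that] .
  then have "K \<union> xpow ` (exps - simplex nvars n) \<subseteq> Idl ?P"
    unfolding K_def using sub genideal_self[OF P] by auto
  then have "Idl (K \<union> xpow ` (exps - simplex nvars n)) \<subseteq> Idl ?P"
    by (rule genideal_minimal[OF genideal_ideal[OF P]])
  moreover have "Idl ?P \<subseteq> Idl (K \<union> xpow ` (exps - simplex nvars n))"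
    using K xs by (intro subset_Idl_subset) (auto simp: K_def)
  ultimately have eq: "Idl (K \<union> xpow ` (exps - simplex nvars n)) = Idl ?P" by blast
  have "\<exists>N. has_colength R (Idl (K \<union> xpow ` (exps - simplex nvars n))) N \<and>
    N \<le> (\<Sum>b\<in>{b \<in> simplex nvars n. xpow b \<notin> K}. weight b) \<and>
    (K = {} \<longrightarrow> N = (\<Sum>b\<in>simplex nvars n. weight b))"
    by (rule has_colength_monomials[OF K]) (auto simp: finite_simplex, auto simp: simplex_def grlex_key_def)
  moreover have "(\<Sum>b\<in>{b \<in> simplex nvars n. xpow b \<notin> K}. weight b) \<le> (\<Sum>b\<in>box nvars q. weight b)"
    by (rule sum_mono2) (auto simp: finite_box K_def simplex_def)
  ultimately show ?thesis unfolding eq using order_trans by blast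
qed

end

section \<open>Hilbert--Samuel multiplicities of parameter ideals\<close>

definition generates_primary :: "('a, 'b) ring_scheme \<Rightarrow> 'a set \<Rightarrow> 'a list \<Rightarrow> bool" where
  "generates_primary R \<mm> xs \<longleftrightarrow>
     set xs \<subseteq> \<mm> \<and> (\<forall>y\<in>\<mm>. \<exists>n::nat. y [^]\<^bsub>R\<^esub> n \<in> Idl\<^bsub>R\<^esub> (set xs))"

context parameter_filtration
begin

definition never_redundant :: "nat set" where
  "never_redundant = {i. i < length us \<and> (\<forall>b. length b = nvars \<longrightarrow> \<not> redundant i b)}"

lemma card_never_redundant_le: "card never_redundant \<le> length us"
proof -
  have "card never_redundant \<le> card {..<length us}"
    by (intro card_mono) (auto simp: never_redundant_def)
  then show ?thesis by simp
qed

lemma sum_weight_le: "(\<Sum>b\<in>B. weight b) \<le> length us * card B"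
proof -
  have "weight b \<le> length us" for b
    unfolding weight_def using card_mono[of "{..<length us}" "{i. i < length us \<and> \<not> redundant i b}"] by auto
  then show ?thesis using sum_bounded_above[of B weight "length us"] by (simp add: mult.commute)
qed

lemma sum_weight_swap:
  assumes "finite B"
  shows "(\<Sum>b\<in>B. weight b) = (\<Sum>i<length us. card {b \<in> B. \<not> redundant i b})"
proof -
  have "weight b = (\<Sum>i<length us. if redundant i b then 0 else 1)" for b
    unfolding weight_def by (simp add: sum.If_cases Int_def conj_commute)
  moreover have "card {b \<in> B. \<not> redundant i b} = (\<Sum>b\<in>B. if redundant i b then 0 else 1)" for i
    using assms by (simp add: sum.If_cases Int_def)
  ultimately show ?thesis by (simp add: sum.swap[of _ B])
qed

lemma sum_weight_ge:
  assumes "finite B" "B \<subseteq> exps"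
  shows "card never_redundant * card B \<le> (\<Sum>b\<in>B. weight b)"
proof -
  have "never_redundant \<subseteq> {i. i < length us \<and> \<not> redundant i b}" if "b \<in> B" for b
    using that assms(2) unfolding never_redundant_def by auto
  then have "card never_redundant \<le> weight b" if "b \<in> B" for b
    unfolding weight_def using that by (intro card_mono) auto
  then show ?thesis using sum_bounded_below[of B "card never_redundant" weight] by (simp add: mult.commute)
qed

lemma sum_weight_asymptotics:
  obtains C where "0 \<le> C"
    and "\<And>q B. 0 < q \<Longrightarrow> B \<subseteq> box nvars q \<Longrightarrow>
      real (\<Sum>b\<in>B. weight b) \<le> real (card never_redundant) * real (card B) + C * real q ^ nvars / real q"
proof -
  have "\<exists>C\<ge>0. \<forall>q>0. (\<exists>a. length a = nvars \<and> redundant i a) \<longrightarrow>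
      real (card {b \<in> box nvars q. \<not> redundant i b}) \<le> C * real q ^ nvars / real q"
    if "i < length us" for i
    by (rule card_avoiding_upset) (rule redundant_mono[OF that])
  then have "\<forall>i\<in>{..<length us}. \<exists>C. 0 \<le> C \<and> (\<forall>q>0. (\<exists>a. length a = nvars \<and> redundant i a) \<longrightarrow>
      real (card {b \<in> box nvars q. \<not> redundant i b}) \<le> C * real q ^ nvars / real q)" by simp
  then obtain C where "\<forall>i\<in>{..<length us}. 0 \<le> C i \<and> (\<forall>q>0. (\<exists>a. length a = nvars \<and> redundant i a) \<longrightarrow>
      real (card {b \<in> box nvars q. \<not> redundant i b}) \<le> C i * real q ^ nvars / real q)"
    by (rule bchoice[THEN exE])
  then have C: "\<And>i. i < length us \<Longrightarrow> 0 \<le> C i"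
    "\<And>i q. i < length us \<Longrightarrow> 0 < q \<Longrightarrow> \<exists>a. length a = nvars \<and> redundant i a \<Longrightarrow>
      real (card {b \<in> box nvars q. \<not> redundant i b}) \<le> C i * real q ^ nvars / real q"
    by simp_all
  have "real (\<Sum>b\<in>B. weight b) \<le>
      real (card never_redundant) * real (card B) + (\<Sum>i<length us. C i) * real q ^ nvars / real q"
    if q: "0 < q" and B: "B \<subseteq> box nvars q" for q B
  proof -
    have fin: "finite B" using finite_subset[OF B finite_box] .
    have "real (card {b \<in> B. \<not> redundant i b}) \<le>
        (if i \<in> never_redundant then real (card B) else 0) + C i * real q ^ nvars / real q"
      if i: "i < length us" for i
    proof (cases "i \<in> never_redundant")
      case True
      have "card {b \<in> B. \<not> redundant i b} \<le> card B" using fin by (intro card_mono) auto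
      moreover have "0 \<le> C i * real q ^ nvars / real q" using C(1)[OF i] by simp
      ultimately show ?thesis using True by simp
    next
      case False
      have "card {b \<in> B. \<not> redundant i b} \<le> card {b \<in> box nvars q. \<not> redundant i b}"
        using B by (intro card_mono) (auto simp: finite_box)
      moreover have "real (card {b \<in> box nvars q. \<not> redundant i b}) \<le> C i * real q ^ nvars / real q"
        by (rule C(2)[OF i q]) (use False i in \<open>auto simp: never_redundant_def\<close>)
      ultimately show ?thesis using False by simp
    qed
    then have "real (\<Sum>b\<in>B. weight b) \<le>
        (\<Sum>i<length us. (if i \<in> never_redundant then real (card B) else 0) + C i * real q ^ nvars / real q)"
      unfolding sum_weight_swap[OF fin] of_nat_sum by (intro sum_mono) simp
    also have "\<dots> = (\<Sum>i<length us. if i \<in> never_redundant then real (card B) else 0)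
        + (\<Sum>i<length us. C i) * real q ^ nvars / real q"
      by (simp add: sum.distrib sum_distrib_right sum_divide_distrib)
    also have "(\<Sum>i<length us. if i \<in> never_redundant then real (card B) else 0) =
        (\<Sum>i\<in>never_redundant. real (card B))"
      by (subst sum.If_cases) (auto intro!: arg_cong[of _ _ card] simp: never_redundant_def Int_def)
    finally show ?thesis by simp
  qed
  moreover have "0 \<le> (\<Sum>i<length us. C i)" using C(1) by (intro sum_nonneg) auto
  ultimately show ?thesis using that by blast
qed

end

lemma (in cring) colength_antimono:
  assumes "ideal I R" "ideal J R" "I \<subseteq> J" "has_colength R I n"
  shows "colength R J \<le> colength R I"
proof -
  obtain m where "m \<le> n" "has_colength R J m"
    using has_colength_superset[OF assms(4,3,2)] .
  then show ?thesis
    using colength_eq[OF is_cring assms(1,4)] colength_eq[OF is_cring assms(2)] by simp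
qed

lemma (in cring) ideal_power: "ideal I R \<Longrightarrow> ideal (I [^]\<^bsub>ideals_set R\<^esub> (n::nat)) R"
  using monoid.nat_pow_closed[OF comm_monoid.axioms(1)[OF ideals_set_is_comm_monoid], of I n]
  by (simp add: ideals_set_def)

lemma (in cring) pow_mem_ideal_power:
  "ideal I R \<Longrightarrow> x \<in> I \<Longrightarrow> x [^] (n::nat) \<in> I [^]\<^bsub>ideals_set R\<^esub> n"
  by (induction n) (auto simp: ideals_set_def intro: ideal_prod.prod)

lemma (in cring) power_of_power_list_subset:
  fixes q n :: nat
  assumes xs: "set xs \<subseteq> carrier R"
  shows "(Idl (set (map (\<lambda>x. x [^] q) xs))) [^]\<^bsub>ideals_set R\<^esub> n \<subseteq> (Idl (set xs)) [^]\<^bsub>ideals_set R\<^esub> (q * n)"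
proof -
  have xsq: "set (map (\<lambda>x. x [^] q) xs) \<subseteq> carrier R" using xs by (auto simp: subset_iff)
  let ?M = "monom_at R xs ` ({b. length b = length xs} - simplex (length xs) (q * n))"
  have M: "?M \<subseteq> carrier R" using xs by auto
  show ?thesis
    unfolding Idl_power_eq_monomials[OF xs] Idl_power_eq_monomials[OF xsq]
  proof (intro genideal_minimal genideal_ideal subsetI)
    fix a assume "a \<in> monom_at R (map (\<lambda>x. x [^] q) xs) `
      ({b. length b = length (map (\<lambda>x. x [^] q) xs)} - simplex (length (map (\<lambda>x. x [^] q) xs)) n)"
    then obtain b where b: "length b = length xs" "\<not> sum_list b < n" "a = monom_at R (map (\<lambda>x. x [^] q) xs) b"
      unfolding simplex_def by auto
    have "a = monom_at R xs (map ((*) q) b)" using monom_at_pow(2)[OF b(1) xs] b(3) by simp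
    moreover have "sum_list (map ((*) q) b) = q * sum_list b" by (simp add: sum_list_const_mult)
    then have "\<not> sum_list (map ((*) q) b) < q * n" using b(2) by (simp add: not_less)
    ultimately have "a \<in> ?M" using b(1) by (auto simp: simplex_def)
    then show "a \<in> Idl ?M" using genideal_self[OF M] by blast
  qed (use M in auto)
qed

locale noetherian_local = cring R + noetherian_ring R for R (structure) +
  fixes \<mm> :: "'a set"
  assumes maximal: "maximalideal \<mm> R"
begin

lemma mm_ideal: "ideal \<mm> R" and one_notin_mm: "\<one> \<notin> \<mm>"
proof -
  show id: "ideal \<mm> R" using maximalideal.axioms(1)[OF maximal] .
  show "\<one> \<notin> \<mm>" using ideal.one_imp_carrier[OF id] maximalideal.I_notcarr[OF maximal] by auto
qed

lemma generates_primary_closed: "generates_primary R \<mm> xs \<Longrightarrow> set xs \<subseteq> carrier R"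
  unfolding generates_primary_def using ideal_subset[OF mm_ideal] by blast

lemma socle_element:
  assumes B: "ideal B R" "B \<noteq> carrier R" and pow: "\<And>y. y \<in> \<mm> \<Longrightarrow> \<exists>n::nat. y [^] n \<in> B"
  obtains u where "u \<in> carrier R" "u \<notin> B" "\<And>r. r \<in> \<mm> \<Longrightarrow> r \<otimes> u \<in> B"
proof -
  obtain Y where Y: "Y \<subseteq> carrier R" "finite Y" "\<mm> = Idl Y"
    using finetely_gen[OF mm_ideal] by blast
  have "\<exists>u\<in>carrier R - B. \<forall>y\<in>Z. y \<otimes> u \<in> B" if "finite Z" "Z \<subseteq> Y" for Z
    using that
  proof induction
    case empty
    then show ?case using ideal_subset[OF B(1)] B(2) by blast
  next
    case (insert y Z)
    obtain u where u: "u \<in> carrier R" "u \<notin> B" "\<forall>z\<in>Z. z \<otimes> u \<in> B"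
      using insert by auto
    have y: "y \<in> carrier R" "y \<in> \<mm>" using insert.prems Y genideal_self[OF Y(1)] by auto
    obtain n :: nat where "y [^] n \<in> B" using pow[OF y(2)] by blast
    then have ex: "y [^] n \<otimes> u \<in> B" using ideal.I_r_closed[OF B(1)] u(1) by blast
    define k where "k = (LEAST k::nat. y [^] k \<otimes> u \<in> B)"
    have k: "y [^] k \<otimes> u \<in> B" unfolding k_def using ex by (rule LeastI)
    then have "k \<noteq> 0" using u by (metis l_one nat_pow_0)
    then obtain j where j: "k = Suc j" using not0_implies_Suc by blast
    have "y [^] j \<otimes> u \<notin> B" using not_less_Least[of j "\<lambda>k. y [^] k \<otimes> u \<in> B"] j unfolding k_def by simp
    moreover have "y \<otimes> (y [^] j \<otimes> u) \<in> B" using k y u unfolding j by (simp add: m_ac)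
    moreover have "z \<otimes> (y [^] j \<otimes> u) \<in> B" if "z \<in> Z" for z
    proof -
      have "z \<in> carrier R" using that insert.prems Y by blast
      then have "z \<otimes> (y [^] j \<otimes> u) = y [^] j \<otimes> (z \<otimes> u)" using y u by (simp add: m_ac)
      then show ?thesis using u(3) that y ideal.I_l_closed[OF B(1)] by simp
    qed
    ultimately show ?case using y u by (intro bexI[of _ "y [^] j \<otimes> u"]) auto
  qed
  then obtain u where u: "u \<in> carrier R - B" "\<forall>y\<in>Y. y \<otimes> u \<in> B" using Y(2) by blast
  then have "r \<otimes> u \<in> B" if "r \<in> \<mm>" for r
    using Idl_mult_right[OF Y(1) B(1), of u r] that Y(3) by blast
  then show ?thesis using that u by blast
qed

lemma exists_parameter_filtration:
  assumes gen: "generates_primary R \<mm> xs"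
  obtains us where "parameter_filtration R \<mm> xs us" "has_colength R (Idl (set xs)) (length us)"
proof -
  have xs: "set xs \<subseteq> carrier R" using generates_primary_closed[OF gen] .
  define B where "B us = Idl (set xs \<union> set us)" for us
  define part where "part us \<longleftrightarrow> set us \<subseteq> carrier R \<and>
     (\<forall>i<length us. us ! i \<notin> B (take i us) \<and> (\<forall>r\<in>\<mm>. r \<otimes> us ! i \<in> B (take i us)))" for us
  have B_ideal: "ideal (B us) R" and B_self: "set xs \<union> set us \<subseteq> B us" if "part us" for us
  proof -
    have "set xs \<union> set us \<subseteq> carrier R" using that xs unfolding part_def by blast
    then show "ideal (B us) R" "set xs \<union> set us \<subseteq> B us"
      unfolding B_def by (rule genideal_ideal, rule genideal_self)
  qed
  define \<A> where "\<A> = B ` {us. part us}"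
  have "part []" unfolding part_def by simp
  then have "\<A> \<noteq> {}" unfolding \<A>_def by blast
  moreover have "\<Union>\<C> \<in> \<A>" if "\<C> \<noteq> {}" "subset.chain \<A> \<C>" for \<C>
  proof -
    have "subset.chain {I. ideal I R} \<C>"
      using that(2) B_ideal unfolding \<A>_def pred_on.chain_def by auto
    then show ?thesis
      using ideal_chain_is_trivial[OF that(1)] that(2) unfolding pred_on.chain_def by blast
  qed
  ultimately obtain M where M: "M \<in> \<A>" "\<forall>X\<in>\<A>. M \<subseteq> X \<longrightarrow> X = M"
    using subset_Zorn_nonempty by blast
  then obtain us where us: "part us" "M = B us" unfolding \<A>_def by blast
  have full: "B us = carrier R"
  proof (rule ccontr)
    assume "B us \<noteq> carrier R"
    moreover have "\<exists>n::nat. y [^] n \<in> B us" if y: "y \<in> \<mm>" for y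
    proof -
      have "Idl (set xs) \<subseteq> B us"
        using B_self[OF us(1)] by (intro genideal_minimal B_ideal us) auto
      then show ?thesis using gen y unfolding generates_primary_def by blast
    qed
    ultimately obtain u where u: "u \<in> carrier R" "u \<notin> B us" "\<And>r. r \<in> \<mm> \<Longrightarrow> r \<otimes> u \<in> B us"
      using socle_element[OF B_ideal[OF us(1)]] by blast
    have part': "part (us @ [u])"
      using us(1) u unfolding part_def by (auto simp: nth_append less_Suc_eq)
    then have "B (us @ [u]) \<in> \<A>" unfolding \<A>_def by blast
    moreover have "B us \<subseteq> B (us @ [u])"
      using B_self[OF part'] unfolding B_def[of us] by (intro genideal_minimal B_ideal part') auto
    ultimately have "B (us @ [u]) = B us" using M(2) us(2) by blast
    then show False using B_self[OF part'] u(2) by auto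
  qed
  have "parameter_filtration R \<mm> xs us"
    using us(1) xs full is_cring maximal unfolding part_def B_def
    by (intro parameter_filtration.intro parameter_filtration_axioms.intro) auto
  moreover have "has_colength R (Idl (set xs)) (0 + card {i. i < length us \<and> us ! i \<notin> Idl (set xs \<union> set (take i us))})"
    using us(1) full has_colength_carrier unfolding part_def B_def
    by (intro has_colength_filtration[OF maximal xs]) auto
  moreover have "{i. i < length us \<and> us ! i \<notin> Idl (set xs \<union> set (take i us))} = {..<length us}"
    using us(1) unfolding part_def B_def by auto
  ultimately show ?thesis using that by simp
qed

lemma multiplicity_bounds:
  assumes gen: "generates_primary R \<mm> xs"
  obtains E C :: real where "0 \<le> E" "0 \<le> C" "E \<le> colength R (Idl (set xs))"
    "\<And>n. E * real (card (simplex (length xs) n)) \<le> colength R ((Idl (set xs)) [^]\<^bsub>ideals_set R\<^esub> n)"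
    "\<And>n. 0 < n \<Longrightarrow> colength R ((Idl (set xs)) [^]\<^bsub>ideals_set R\<^esub> n) \<le>
        E * real (card (simplex (length xs) n)) + C * real n ^ length xs / real n"
    "\<And>q. 0 < q \<Longrightarrow> colength R (Idl (set (map (\<lambda>x. x [^] q) xs))) \<le>
        E * real q ^ length xs + C * real q ^ length xs / real q"
proof -
  obtain us where us: "parameter_filtration R \<mm> xs us" and len: "has_colength R (Idl (set xs)) (length us)"
    using exists_parameter_filtration[OF gen] .
  interpret F: parameter_filtration R \<mm> xs us by fact
  define E where "E = real (card F.never_redundant)"
  obtain C where C: "0 \<le> C" "\<And>q B. 0 < q \<Longrightarrow> B \<subseteq> box (length xs) q \<Longrightarrow>
      real (\<Sum>b\<in>B. F.weight b) \<le> E * real (card B) + C * real q ^ length xs / real q"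
    unfolding E_def using F.sum_weight_asymptotics by blast
  have J: "ideal (Idl (set xs)) R" using genideal_ideal[OF F.xs] .
  have cn: "colength R ((Idl (set xs)) [^]\<^bsub>ideals_set R\<^esub> n) = real (\<Sum>b\<in>simplex (length xs) n. F.weight b)" for n
    using colength_eq[OF is_cring ideal_power[OF J] F.has_colength_power] .
  show ?thesis
  proof (rule that[of E C])
    show "E \<le> colength R (Idl (set xs))"
      using F.card_never_redundant_le colength_eq[OF is_cring J len] unfolding E_def by simp
    show "E * real (card (simplex (length xs) n)) \<le> colength R ((Idl (set xs)) [^]\<^bsub>ideals_set R\<^esub> n)" for n
    proof -
      have "card F.never_redundant * card (simplex (length xs) n) \<le> (\<Sum>b\<in>simplex (length xs) n. F.weight b)"
        by (rule F.sum_weight_ge[OF finite_simplex]) (auto simp: simplex_def)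
      then show ?thesis unfolding cn E_def by (metis of_nat_le_iff of_nat_mult)
    qed
    show "colength R ((Idl (set xs)) [^]\<^bsub>ideals_set R\<^esub> n) \<le>
        E * real (card (simplex (length xs) n)) + C * real n ^ length xs / real n" if "0 < n" for n
      unfolding cn using C(2)[OF that simplex_subset_box] .
    show "colength R (Idl (set (map (\<lambda>x. x [^] q) xs))) \<le>
        E * real q ^ length xs + C * real q ^ length xs / real q" if q: "0 < q" for q
    proof -
      obtain N where N: "has_colength R (Idl (set (map (\<lambda>x. x [^] q) xs))) N"
        "N \<le> (\<Sum>b\<in>box (length xs) q. F.weight b)"
        using F.has_colength_power_list[OF q] by blast
      have "ideal (Idl (set (map (\<lambda>x. x [^] q) xs))) R"
        using F.xs by (intro genideal_ideal) auto
      then have "colength R (Idl (set (map (\<lambda>x. x [^] q) xs))) \<le> real (\<Sum>b\<in>box (length xs) q. F.weight b)"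
        using colength_eq[OF is_cring _ N(1)] N(2) by (simp del: of_nat_sum)
      also have "\<dots> \<le> E * real (card (box (length xs) q)) + C * real q ^ length xs / real q"
        using C(2)[OF q order_refl] .
      finally show ?thesis by (simp add: card_box)
    qed
  qed (use C in \<open>auto simp: E_def\<close>)
qed

lemma has_colength_power:
  assumes gen: "generates_primary R \<mm> xs"
  obtains N where "has_colength R ((Idl (set xs)) [^]\<^bsub>ideals_set R\<^esub> n) N"
    "real N \<le> colength R (Idl (set xs)) * real (card (simplex (length xs) n))"
proof -
  obtain us where us: "parameter_filtration R \<mm> xs us" and len: "has_colength R (Idl (set xs)) (length us)"
    using exists_parameter_filtration[OF gen] .
  interpret F: parameter_filtration R \<mm> xs us by fact
  have "real (\<Sum>b\<in>simplex (length xs) n. F.weight b) \<le> colength R (Idl (set xs)) * real (card (simplex (length xs) n))"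
    using F.sum_weight_le[of "simplex (length xs) n"] colength_eq[OF is_cring genideal_ideal[OF F.xs] len]
    by (metis of_nat_le_iff of_nat_mult)
  then show ?thesis using that F.has_colength_power by blast
qed

lemma generates_primary_power_list:
  assumes gen: "generates_primary R \<mm> xs" and q: "0 < (q::nat)"
  shows "generates_primary R \<mm> (map (\<lambda>x. x [^] q) xs)"
  unfolding generates_primary_def
proof (intro conjI ballI)
  have xs: "set xs \<subseteq> carrier R" using generates_primary_closed[OF gen] .
  show "set (map (\<lambda>x. x [^] q) xs) \<subseteq> \<mm>"
  proof
    fix y assume "y \<in> set (map (\<lambda>x. x [^] q) xs)"
    then obtain x where x: "x \<in> set xs" "y = x [^] q" by auto
    obtain j where "q = Suc j" using q gr0_conv_Suc by blast
    moreover have "x \<in> \<mm>" using gen x unfolding generates_primary_def by blast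
    ultimately show "y \<in> \<mm>" using x xs ideal.I_l_closed[OF mm_ideal] by auto
  qed
  fix y assume y: "y \<in> \<mm>"
  then have yc: "y \<in> carrier R" using ideal_subset[OF mm_ideal] by blast
  obtain n :: nat where n: "y [^] n \<in> Idl (set xs)" using gen y unfolding generates_primary_def by blast
  have "(y [^] n) [^] (length xs * q + 1) \<in> Idl (set (map (\<lambda>x. x [^] q) xs))"
    using pow_mem_ideal_power[OF genideal_ideal[OF xs] n] Idl_power_subset_power_list[OF xs] by blast
  then show "\<exists>n::nat. y [^] n \<in> Idl (set (map (\<lambda>x. x [^] q) xs))"
    unfolding nat_pow_pow[OF yc] by blast
qed

lemma multiplicity_limits:
  assumes gen: "generates_primary R \<mm> xs"
  obtains e :: real where "0 \<le> e" "e \<le> colength R (Idl (set xs))"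
    "(\<lambda>n. fact (length xs) * colength R ((Idl (set xs)) [^]\<^bsub>ideals_set R\<^esub> n) / real n ^ length xs) \<longlonglongrightarrow> e"
    "(\<lambda>q. colength R (Idl (set (map (\<lambda>x. x [^] q) xs))) / real q ^ length xs) \<longlonglongrightarrow> e"
proof -
  define d where "d = length xs"
  define J where "J = Idl (set xs)"
  define Jq where "Jq q = Idl (set (map (\<lambda>x. x [^] (q::nat)) xs))" for q
  have xs: "set xs \<subseteq> carrier R" using generates_primary_closed[OF gen] .
  define S where "S n = fact d * real (card (simplex d n)) / real n ^ d" for n
  have S: "S \<longlonglongrightarrow> 1" unfolding S_def by (rule card_simplex_limit)
  obtain E C where E: "0 \<le> E" "0 \<le> C" "E \<le> colength R J"
    "\<And>n. E * real (card (simplex d n)) \<le> colength R (J [^]\<^bsub>ideals_set R\<^esub> n)"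
    "\<And>n. 0 < n \<Longrightarrow> colength R (J [^]\<^bsub>ideals_set R\<^esub> n) \<le>
        E * real (card (simplex d n)) + C * real n ^ d / real n"
    "\<And>q. 0 < q \<Longrightarrow> colength R (Jq q) \<le> E * real q ^ d + C * real q ^ d / real q"
    using multiplicity_bounds[OF gen] unfolding d_def J_def Jq_def by metis
  have C0: "(\<lambda>n. C / real n) \<longlonglongrightarrow> 0" by (rule lim_const_over_n)
  have hs: "(\<lambda>n. fact d * colength R (J [^]\<^bsub>ideals_set R\<^esub> n) / real n ^ d) \<longlonglongrightarrow> E"
  proof (rule tendsto_sandwich[where f = "\<lambda>n. E * S n" and h = "\<lambda>n. E * S n + fact d * (C / real n)"])
    show "\<forall>\<^sub>F n in sequentially. E * S n \<le> fact d * colength R (J [^]\<^bsub>ideals_set R\<^esub> n) / real n ^ d"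
    proof (intro always_eventually allI)
      fix n
      have "fact d * (E * real (card (simplex d n))) / real n ^ d \<le> fact d * colength R (J [^]\<^bsub>ideals_set R\<^esub> n) / real n ^ d"
        by (intro divide_right_mono mult_left_mono E(4)) auto
      then show "E * S n \<le> fact d * colength R (J [^]\<^bsub>ideals_set R\<^esub> n) / real n ^ d"
        unfolding S_def by (simp add: mult_ac)
    qed
    show "\<forall>\<^sub>F n in sequentially. fact d * colength R (J [^]\<^bsub>ideals_set R\<^esub> n) / real n ^ d \<le> E * S n + fact d * (C / real n)"
      using eventually_gt_at_top[of 0]
    proof eventually_elim
      case (elim n)
      have "fact d * colength R (J [^]\<^bsub>ideals_set R\<^esub> n) / real n ^ d
          \<le> fact d * (E * real (card (simplex d n)) + C * real n ^ d / real n) / real n ^ d"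
        by (intro divide_right_mono mult_left_mono E(5)[OF elim]) auto
      also have "\<dots> = E * S n + fact d * (C / real n)"
        unfolding S_def using elim by (simp add: field_simps)
      finally show ?case .
    qed
    show "(\<lambda>n. E * S n) \<longlonglongrightarrow> E" using tendsto_mult_left[OF S, of E] by simp
    show "(\<lambda>n. E * S n + fact d * (C / real n)) \<longlonglongrightarrow> E"
      using tendsto_add[OF tendsto_mult_left[OF S, of E] tendsto_mult_left[OF C0, of "fact d"]] by simp
  qed
  have lower: "E * real q ^ d \<le> colength R (Jq q)" if q: "0 < q" for q
  proof -
    have gen': "generates_primary R \<mm> (map (\<lambda>x. x [^] q) xs)" using generates_primary_power_list[OF gen q] .
    have "E * real (card (simplex d (q * n))) \<le> colength R (Jq q) * real (card (simplex d n))" for n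
    proof -
      obtain N where N: "has_colength R ((Jq q) [^]\<^bsub>ideals_set R\<^esub> n) N"
        "real N \<le> colength R (Jq q) * real (card (simplex d n))"
        using has_colength_power[OF gen', of n] unfolding Jq_def d_def by auto
      have id: "ideal ((Jq q) [^]\<^bsub>ideals_set R\<^esub> n) R" "ideal (J [^]\<^bsub>ideals_set R\<^esub> (q * n)) R"
        unfolding Jq_def J_def using xs generates_primary_closed[OF gen']
        by (intro ideal_power genideal_ideal; simp)+
      have "colength R (J [^]\<^bsub>ideals_set R\<^esub> (q * n)) \<le> colength R ((Jq q) [^]\<^bsub>ideals_set R\<^esub> n)"
        using power_of_power_list_subset[OF xs] unfolding J_def Jq_def
        by (intro colength_antimono[OF _ _ _ N(1)[unfolded Jq_def]] id[unfolded J_def Jq_def])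
      then show ?thesis using E(4)[of "q * n"] N(2) colength_eq[OF is_cring id(1) N(1)] by linarith
    qed
    then have "fact d * (E * real (card (simplex d (q * n)))) / real n ^ d
        \<le> fact d * (colength R (Jq q) * real (card (simplex d n))) / real n ^ d" for n
      by (intro divide_right_mono mult_left_mono) auto
    then have "E * real q ^ d * S (q * n) \<le> colength R (Jq q) * S n" for n
      unfolding S_def using q by (simp add: field_simps power_mult_distrib)
    moreover have "(\<lambda>n. E * real q ^ d * S (q * n)) \<longlonglongrightarrow> E * real q ^ d * 1"
      using LIMSEQ_subseq_LIMSEQ[OF S, of "(*) q"] q
      by (intro tendsto_mult_left) (simp add: strict_mono_def comp_def)
    moreover have "(\<lambda>n. colength R (Jq q) * S n) \<longlonglongrightarrow> colength R (Jq q) * 1"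
      by (intro tendsto_mult_left S)
    ultimately show ?thesis using LIMSEQ_le by fastforce
  qed
  have "(\<lambda>q. colength R (Jq q) / real q ^ d) \<longlonglongrightarrow> E"
  proof (rule tendsto_sandwich[where f = "\<lambda>_. E" and h = "\<lambda>q. E + C / real q"])
    show "\<forall>\<^sub>F q in sequentially. E \<le> colength R (Jq q) / real q ^ d"
      using eventually_gt_at_top[of 0] by eventually_elim (use lower in \<open>auto simp: le_divide_eq\<close>)
    show "\<forall>\<^sub>F q in sequentially. colength R (Jq q) / real q ^ d \<le> E + C / real q"
      using eventually_gt_at_top[of 0]
    proof eventually_elim
      case (elim q)
      have "colength R (Jq q) / real q ^ d \<le> (E * real q ^ d + C * real q ^ d / real q) / real q ^ d"
        by (intro divide_right_mono E(6)[OF elim]) auto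
      then show ?case using elim by (simp add: field_simps)
    qed
    show "(\<lambda>q. E + C / real q) \<longlonglongrightarrow> E" using tendsto_add[OF tendsto_const C0, of E] by simp
  qed simp
  then show ?thesis using that E(1,3) hs unfolding J_def Jq_def d_def by blast
qed

end

section \<open>Frobenius powers and F-thresholds\<close>

lemma (in cring) binomial_expansion:
  assumes [simp]: "x \<in> carrier R" "y \<in> carrier R"
  shows "(x \<oplus> y) [^] (n::nat) = (\<Oplus>k\<in>{..n}. add_pow R (n choose k) (x [^] k \<otimes> y [^] (n - k)))"
proof (induction n)
  case (Suc n)
  define T where "T m k = add_pow R (m choose k) (x [^] k \<otimes> y [^] (m - k))" for m k :: nat
  have [simp]: "T m k \<in> carrier R" for m k unfolding T_def by simp
  have xT: "x \<otimes> T n k \<oplus> y \<otimes> T n (Suc k) = T (Suc n) (Suc k)" if "k \<le> n" for k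
  proof -
    have "y \<otimes> T n (Suc k) = add_pow R (n choose Suc k) (x [^] Suc k \<otimes> y [^] (n - k))"
    proof (cases "k < n")
      case True
      then have "y [^] (n - k) = y [^] (n - Suc k) \<otimes> y" by (metis Suc_diff_Suc nat_pow_Suc)
      then show ?thesis unfolding T_def by (simp add: add_pow_rdistr m_ac del: nat_pow_Suc)
    qed (use that in \<open>simp add: T_def binomial_eq_0\<close>)
    moreover have "x \<otimes> T n k = add_pow R (n choose k) (x [^] Suc k \<otimes> y [^] (n - k))"
      unfolding T_def by (simp add: add_pow_rdistr m_ac)
    ultimately show ?thesis unfolding T_def by (simp add: add.nat_pow_mult)
  qed
  have "(x \<oplus> y) [^] Suc n = (x \<oplus> y) \<otimes> (\<Oplus>k\<in>{..n}. T n k)"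
    using Suc unfolding T_def by (simp add: m_comm)
  also have "\<dots> = x \<otimes> (\<Oplus>k\<in>{..n}. T n k) \<oplus> y \<otimes> (\<Oplus>k\<in>{..n}. T n k)" by (simp add: l_distr)
  also have "(\<Oplus>k\<in>{..n}. T n k) = (\<Oplus>k\<in>{..Suc n}. T n k)" by (simp add: T_def binomial_eq_0)
  also have "y \<otimes> (\<Oplus>k\<in>{..Suc n}. T n k) = (\<Oplus>k\<in>{..n}. y \<otimes> T n (Suc k)) \<oplus> y \<otimes> T n 0"
    by (subst finsum_Suc2) (simp_all add: r_distr finsum_rdistr del: finsum_Suc)
  also have "x \<otimes> (\<Oplus>k\<in>{..Suc n}. T n k) = (\<Oplus>k\<in>{..n}. x \<otimes> T n k)"
    by (simp add: T_def finsum_rdistr binomial_eq_0)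
  also have "(\<Oplus>k\<in>{..n}. x \<otimes> T n k) \<oplus> ((\<Oplus>k\<in>{..n}. y \<otimes> T n (Suc k)) \<oplus> y \<otimes> T n 0)
      = (\<Oplus>k\<in>{..n}. x \<otimes> T n k \<oplus> y \<otimes> T n (Suc k)) \<oplus> y \<otimes> T n 0"
    by (simp add: finsum_addf a_assoc)
  also have "(\<Oplus>k\<in>{..n}. x \<otimes> T n k \<oplus> y \<otimes> T n (Suc k)) = (\<Oplus>k\<in>{..n}. T (Suc n) (Suc k))"
    using xT by (intro finsum_cong') auto
  also have "y \<otimes> T n 0 = T (Suc n) 0" by (simp add: T_def m_comm)
  also have "(\<Oplus>k\<in>{..n}. T (Suc n) (Suc k)) \<oplus> T (Suc n) 0 = (\<Oplus>k\<in>{..Suc n}. T (Suc n) k)"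
    by (subst finsum_Suc2) (simp_all del: finsum_Suc)
  finally show ?case unfolding T_def .
qed simp

locale noetherian_local_char = noetherian_local +
  fixes p :: nat
  assumes prime_p: "Factorial_Ring.prime p" and char_p: "add_pow R p \<one> = \<zero>"
begin

lemma p_power_pos: "0 < p ^ e"
  using prime_p by (simp add: prime_gt_0_nat)

lemma add_pow_multiple: "p dvd n \<Longrightarrow> x \<in> carrier R \<Longrightarrow> add_pow R n x = \<zero>"
proof (elim dvdE)
  fix k assume n: "n = p * k" and x: "x \<in> carrier R"
  have "add_pow R p x = (add_pow R p \<one>) \<otimes> x" using x by (simp add: add_pow_ldistr)
  then have "add_pow R p x = \<zero>" using char_p x by simp
  then show "add_pow R n x = \<zero>" unfolding n using x by (simp flip: add.nat_pow_pow)
qed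

lemma frobenius_add:
  assumes [simp]: "x \<in> carrier R" "y \<in> carrier R"
  shows "(x \<oplus> y) [^] p = x [^] p \<oplus> y [^] p"
proof -
  obtain m where m: "p = Suc (Suc m)"
    using prime_ge_2_nat[OF prime_p] by (metis Suc_le_D numeral_2_eq_2 Suc_le_mono)
  define T where "T k = add_pow R (p choose k) (x [^] k \<otimes> y [^] (p - k))" for k :: nat
  have [simp]: "T k \<in> carrier R" for k unfolding T_def by simp
  have "T (Suc i) = \<zero>" if "i \<le> m" for i
    unfolding T_def using that m prime_p by (intro add_pow_multiple dvd_choose_prime) auto
  then have "(\<Oplus>i\<in>{..m}. T (Suc i)) = \<zero>" by (intro add.finprod_one_eqI) auto
  then have "(\<Oplus>k\<in>{..Suc m}. T k) = T 0" by (subst finsum_Suc2) (simp_all del: finsum_Suc)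
  then have "(\<Oplus>k\<in>{..p}. T k) = T p \<oplus> T 0" unfolding m by (subst finsum_Suc) simp_all
  then show ?thesis using binomial_expansion[of x y p] by (simp add: T_def)
qed

lemma frobenius_pow_add:
  assumes "x \<in> carrier R" "y \<in> carrier R"
  shows "(x \<oplus> y) [^] (p ^ e) = x [^] (p ^ e) \<oplus> y [^] (p ^ e)"
proof (induction e)
  case (Suc e)
  have "(x \<oplus> y) [^] (p ^ Suc e) = ((x \<oplus> y) [^] (p ^ e)) [^] p"
    using assms by (simp add: nat_pow_pow mult.commute)
  also have "\<dots> = (x [^] (p ^ e)) [^] p \<oplus> (y [^] (p ^ e)) [^] p"
    unfolding Suc using assms by (intro frobenius_add) auto
  also have "\<dots> = x [^] (p ^ Suc e) \<oplus> y [^] (p ^ Suc e)"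
    using assms by (simp add: nat_pow_pow mult.commute)
  finally show ?case .
qed (use assms in simp)

lemma frobenius_pow_mem_Idl:
  assumes A: "A \<subseteq> carrier R" and "x \<in> Idl A"
  shows "x [^] (p ^ e) \<in> Idl ((\<lambda>x. x [^] (p ^ e)) ` A)"
proof -
  let ?K = "Idl ((\<lambda>x. x [^] (p ^ e)) ` A)"
  have sub: "(\<lambda>x. x [^] (p ^ e)) ` A \<subseteq> carrier R" using A by auto
  interpret K: ideal ?K R by (rule genideal_ideal[OF sub])
  have zero: "\<zero> [^] (p ^ e) = \<zero>" using p_power_pos[of e] nat_pow_zero by simp
  have neg: "(\<ominus> x) [^] (p ^ e) = \<ominus> (x [^] (p ^ e))" if "x \<in> carrier R" for x
  proof -
    have "(\<ominus> x) [^] (p ^ e) \<oplus> x [^] (p ^ e) = \<zero>"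
      using frobenius_pow_add[of "\<ominus> x" x e] that zero by (simp add: l_neg)
    then show ?thesis using that by (simp add: minus_equality)
  qed
  have "ideal {x \<in> carrier R. x [^] (p ^ e) \<in> ?K} R"
  proof (rule idealI[OF ring_axioms])
    show "subgroup {x \<in> carrier R. x [^] (p ^ e) \<in> ?K} (add_monoid R)"
      by (rule subgroup.intro) (auto simp: frobenius_pow_add zero neg simp flip: a_inv_def)
  qed (auto simp: nat_pow_distrib K.I_l_closed K.I_r_closed)
  then have "Idl A \<subseteq> {x \<in> carrier R. x [^] (p ^ e) \<in> ?K}"
    using A genideal_self[OF sub] by (intro genideal_minimal) auto
  then show ?thesis using assms(2) by blast
qed

lemma frobenius_power_Idl:
  assumes xs: "set xs \<subseteq> carrier R"
  shows "frobenius_power p R (Idl (set xs)) e = Idl (set (map (\<lambda>x. x [^] (p ^ e)) xs))"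
proof -
  have sub: "set (map (\<lambda>x. x [^] (p ^ e)) xs) \<subseteq> carrier R" using xs by auto
  have J: "Idl (set xs) \<subseteq> carrier R" using ideal_subset[OF genideal_ideal[OF xs]] .
  show ?thesis
    unfolding frobenius_power_def
  proof
    show "Idl ((\<lambda>x. x [^] (p ^ e)) ` (Idl (set xs))) \<subseteq> Idl (set (map (\<lambda>x. x [^] (p ^ e)) xs))"
      using frobenius_pow_mem_Idl[OF xs] by (intro genideal_minimal genideal_ideal sub) auto
    show "Idl (set (map (\<lambda>x. x [^] (p ^ e)) xs)) \<subseteq> Idl ((\<lambda>x. x [^] (p ^ e)) ` (Idl (set xs)))"
      using genideal_self[OF xs] J by (intro subset_Idl_subset) auto
  qed
qed

lemma frobenius_pow_mem_frobenius_power: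
  assumes ys: "set ys \<subseteq> carrier R" and x: "x \<in> frobenius_power p R (Idl (set ys)) n"
  shows "x [^] (p ^ e) \<in> frobenius_power p R (Idl (set ys)) (n + e)"
proof -
  have sub: "set (map (\<lambda>x. x [^] (p ^ n)) ys) \<subseteq> carrier R" using ys by auto
  have "(\<lambda>x. x [^] (p ^ e)) ` set (map (\<lambda>x. x [^] (p ^ n)) ys) = set (map (\<lambda>x. x [^] (p ^ (n + e))) ys)"
    using ys by (force simp: nat_pow_pow power_add image_image)
  then show ?thesis
    using frobenius_pow_mem_Idl[OF sub] x unfolding frobenius_power_Idl[OF ys] by metis
qed

end

lemma list_div_mod:
  fixes r :: nat
  assumes "0 < r"
  shows "b = add_exp (map ((*) r) (map (\<lambda>k. k div r) b)) (map (\<lambda>k. k mod r) b)"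
    and "sum_list (map (\<lambda>k. k mod r) b) \<le> r * length b"
  unfolding add_exp_def using assms
  by (induction b) (auto intro: add_mono less_imp_le)

lemma (in cring) Idl_power_antimono:
  fixes m n :: nat
  assumes "set xs \<subseteq> carrier R" "m \<le> n"
  shows "(Idl (set xs)) [^]\<^bsub>ideals_set R\<^esub> n \<subseteq> (Idl (set xs)) [^]\<^bsub>ideals_set R\<^esub> m"
  unfolding Idl_power_eq_monomials[OF assms(1)]
  by (rule subset_Idl_subset) (use assms in \<open>auto simp: simplex_def\<close>)

context noetherian_local_char
begin

lemma power_subset_frobenius_power:
  assumes xs: "set xs \<subseteq> carrier R" and ys: "set ys \<subseteq> carrier R"
    and N: "(Idl (set xs)) [^]\<^bsub>ideals_set R\<^esub> N \<subseteq> frobenius_power p R (Idl (set ys)) n"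
  shows "(Idl (set xs)) [^]\<^bsub>ideals_set R\<^esub> (p ^ e * (N + length xs)) \<subseteq>
    frobenius_power p R (Idl (set ys)) (n + e)"
proof -
  let ?F = "frobenius_power p R (Idl (set ys)) (n + e)"
  have F: "ideal ?F R"
    unfolding frobenius_power_Idl[OF ys] using ys by (intro genideal_ideal) auto
  let ?M = "\<lambda>N. monom_at R xs ` ({b. length b = length xs} - simplex (length xs) N)"
  show ?thesis
    unfolding Idl_power_eq_monomials[OF xs]
  proof (intro genideal_minimal[OF F] subsetI)
    fix a assume "a \<in> ?M (p ^ e * (N + length xs))"
    then obtain b where b: "length b = length xs" "p ^ e * (N + length xs) \<le> sum_list b" "a = monom_at R xs b"
      unfolding simplex_def by (auto simp flip: not_less)
    define c where "c = map (\<lambda>k. k div p ^ e) b"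
    define s where "s = map (\<lambda>k. k mod p ^ e) b"
    have len: "length c = length xs" "length s = length xs" using b unfolding c_def s_def by auto
    have dm: "b = add_exp (map ((*) (p ^ e)) c) s" "sum_list s \<le> p ^ e * length xs"
      using list_div_mod[OF p_power_pos[of e], of b] b(1) unfolding c_def s_def by simp_all
    have "sum_list b = p ^ e * sum_list c + sum_list s"
      using len by (subst dm(1)) (simp add: sum_list_add_exp sum_list_const_mult)
    then have "p ^ e * (N + length xs) \<le> p ^ e * (sum_list c + length xs)"
      using b(2) dm(2) unfolding distrib_left by linarith
    then have "N \<le> sum_list c" using p_power_pos[of e] by auto
    then have "monom_at R xs c \<in> ?M N" using len by (auto simp: simplex_def)
    moreover have "?M N \<subseteq> carrier R" using xs by auto
    ultimately have "monom_at R xs c \<in> frobenius_power p R (Idl (set ys)) n"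
      using N genideal_self unfolding Idl_power_eq_monomials[OF xs] by blast
    then have "monom_at R xs c [^] (p ^ e) \<in> ?F" by (rule frobenius_pow_mem_frobenius_power[OF ys])
    moreover have "a = monom_at R xs c [^] (p ^ e) \<otimes> monom_at R xs s"
      unfolding b(3) using len xs by (subst dm(1)) (simp add: monom_at_add_exp monom_at_pow(1))
    ultimately show "a \<in> ?F" using ideal.I_r_closed[OF F] xs by simp
  qed
qed

lemma uniform_power:
  assumes gen: "generates_primary R \<mm> ys" and xs: "set xs \<subseteq> \<mm>"
  shows "\<exists>M::nat. \<forall>x\<in>set xs. \<forall>k\<ge>M. x [^] k \<in> Idl (set ys)"
proof -
  have J: "ideal (Idl (set ys)) R" using genideal_ideal[OF generates_primary_closed[OF gen]] .
  have "\<forall>x\<in>set xs. \<exists>n::nat. x [^] n \<in> Idl (set ys)"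
    using gen xs unfolding generates_primary_def by blast
  then obtain f :: "'a \<Rightarrow> nat" where f: "\<forall>x\<in>set xs. x [^] f x \<in> Idl (set ys)"
    by (rule bchoice[THEN exE])
  have "x [^] k \<in> Idl (set ys)" if x: "x \<in> set xs" and k: "(\<Sum>x\<in>set xs. f x) \<le> k" for x k
  proof -
    have "f x \<le> (\<Sum>x\<in>set xs. f x)" using x by (intro member_le_sum) auto
    then have "k = f x + (k - f x)" using k by simp
    moreover have xc: "x \<in> carrier R" using x xs ideal_subset[OF mm_ideal] by blast
    ultimately have "x [^] k = x [^] f x \<otimes> x [^] (k - f x)" by (metis nat_pow_mult)
    then show ?thesis using f x xc ideal.I_r_closed[OF J] by simp
  qed
  then show ?thesis by blast
qed

lemma frobenius_power_subset_mm:
  assumes gen: "generates_primary R \<mm> ys"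
  shows "ideal (frobenius_power p R (Idl (set ys)) n) R" "frobenius_power p R (Idl (set ys)) n \<subseteq> \<mm>"
proof -
  have gen': "generates_primary R \<mm> (map (\<lambda>x. x [^] (p ^ n)) ys)"
    using generates_primary_power_list[OF gen p_power_pos] .
  show "ideal (frobenius_power p R (Idl (set ys)) n) R"
    unfolding frobenius_power_Idl[OF generates_primary_closed[OF gen]]
    using generates_primary_closed[OF gen'] by (rule genideal_ideal)
  show "frobenius_power p R (Idl (set ys)) n \<subseteq> \<mm>"
    unfolding frobenius_power_Idl[OF generates_primary_closed[OF gen]]
    using gen' unfolding generates_primary_def by (intro genideal_minimal mm_ideal) blast
qed

definition nu :: "'a list \<Rightarrow> 'a list \<Rightarrow> nat \<Rightarrow> nat" where
  "nu xs ys n = Max {t. \<not> (Idl (set xs)) [^]\<^bsub>ideals_set R\<^esub> t \<subseteq> frobenius_power p R (Idl (set ys)) n}"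

lemma nu_set:
  assumes xs: "generates_primary R \<mm> xs" and ys: "generates_primary R \<mm> ys"
  shows "{t. \<not> (Idl (set xs)) [^]\<^bsub>ideals_set R\<^esub> t \<subseteq> frobenius_power p R (Idl (set ys)) n} = {..nu xs ys n}"
proof -
  let ?S = "{t::nat. \<not> (Idl (set xs)) [^]\<^bsub>ideals_set R\<^esub> t \<subseteq> frobenius_power p R (Idl (set ys)) n}"
  have xsc: "set xs \<subseteq> carrier R" and ysc: "set ys \<subseteq> carrier R"
    using xs ys generates_primary_closed by auto
  have gen': "generates_primary R \<mm> (map (\<lambda>x. x [^] (p ^ n)) ys)"
    using generates_primary_power_list[OF ys p_power_pos] .
  have xsm: "set xs \<subseteq> \<mm>" using xs unfolding generates_primary_def by simp
  obtain M :: nat where M: "\<forall>x\<in>set xs. \<forall>k\<ge>M. x [^] k \<in> Idl (set (map (\<lambda>x. x [^] (p ^ n)) ys))"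
    using uniform_power[OF gen' xsm] by blast
  have "Idl (set (map (\<lambda>x. x [^] M) xs)) \<subseteq> frobenius_power p R (Idl (set ys)) n"
    using M frobenius_power_subset_mm(1)[OF ys, of n]
    unfolding frobenius_power_Idl[OF ysc] by (intro genideal_minimal) auto
  then have top: "length xs * M + 1 \<notin> ?S" using Idl_power_subset_power_list[OF xsc, of M] by blast
  have down: "s \<in> ?S" if "t \<in> ?S" "s \<le> t" for s t
    using Idl_power_antimono[OF xsc that(2)] that(1) by blast
  have "\<one> \<notin> frobenius_power p R (Idl (set ys)) n"
    using frobenius_power_subset_mm(2)[OF ys] one_notin_mm by blast
  then have "0 \<in> ?S" by (auto simp: ideals_set_def)
  moreover have bd: "?S \<subseteq> {..length xs * M + 1}"
    using down top by (metis (no_types, lifting) atMost_iff nle_le subsetI)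
  ultimately have "nu xs ys n \<in> ?S" "\<And>t. t \<in> ?S \<Longrightarrow> t \<le> nu xs ys n"
    unfolding nu_def using Max_in[of ?S] Max_ge[of ?S] finite_subset[OF bd] by blast+
  then show ?thesis using down by blast
qed

lemma nu_growth:
  assumes xs: "generates_primary R \<mm> xs" and ys: "generates_primary R \<mm> ys"
  shows "nu xs ys (n + e) \<le> p ^ e * (nu xs ys n + 1 + length xs)"
proof -
  have "nu xs ys n + 1 \<notin> {..nu xs ys n}" by simp
  then have "(Idl (set xs)) [^]\<^bsub>ideals_set R\<^esub> (nu xs ys n + 1) \<subseteq> frobenius_power p R (Idl (set ys)) n"
    unfolding nu_set[OF xs ys, symmetric] by blast
  from power_subset_frobenius_power[OF _ _ this]
  have "p ^ e * (nu xs ys n + 1 + length xs) \<notin> {..nu xs ys (n + e)}"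
    unfolding nu_set[OF xs ys, symmetric] using xs ys generates_primary_closed by blast
  then show ?thesis by simp
qed

end

lemma convergent_almost_decreasing:
  fixes v :: "nat \<Rightarrow> real"
  assumes nonneg: "\<And>n. 0 \<le> v n" and step: "\<And>n e. v (n + e) \<le> v n + w n" and w: "w \<longlonglongrightarrow> 0"
  shows "convergent v"
proof -
  define L where "L = (INF n. v n + w n)"
  have "0 \<le> v n + w n" for n using nonneg step[of n 0] nonneg[of "n + 0"] by (meson order_trans)
  then have bdd: "bdd_below (range (\<lambda>n. v n + w n))" by (auto intro: bdd_belowI[of _ 0])
  have "v \<longlonglongrightarrow> L"
  proof (rule LIMSEQ_I)
    fix \<epsilon> :: real assume \<epsilon>: "0 < \<epsilon>"
    have "(INF n. v n + w n) < L + \<epsilon>" using \<epsilon> unfolding L_def by simp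
    then obtain n where n: "v n + w n < L + \<epsilon>" using cINF_less_iff[OF _ bdd] by auto
    obtain m0 where m0: "\<And>m. m0 \<le> m \<Longrightarrow> norm (w m - 0) < \<epsilon>" using LIMSEQ_D[OF w \<epsilon>] by auto
    have "norm (v m - L) < \<epsilon>" if "max n m0 \<le> m" for m
    proof -
      have "v m \<le> v n + w n" using step[of n "m - n"] that by simp
      moreover have "L \<le> v m + w m" unfolding L_def by (rule cINF_lower[OF bdd]) simp
      ultimately show ?thesis using n m0[of m] that by (auto simp: abs_real_def split: if_splits)
    qed
    then show "\<exists>no. \<forall>m\<ge>no. norm (v m - L) < \<epsilon>" by blast
  qed
  then show ?thesis by (rule convergentI)
qed

context noetherian_local_char
begin

lemma p_power_tendsto: "(\<lambda>n. a / real (p ^ n)) \<longlonglongrightarrow> 0"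
proof -
  have "1 < real p" using prime_gt_1_nat[OF prime_p] by simp
  then have "(\<lambda>n. a * inverse (real p ^ n)) \<longlonglongrightarrow> a * 0"
    by (intro tendsto_mult_left LIMSEQ_inverse_realpow_zero)
  then show ?thesis by (simp add: divide_inverse)
qed

lemma F_threshold_limit:
  assumes xs: "generates_primary R \<mm> xs" and ys: "generates_primary R \<mm> ys"
  shows "(\<lambda>n. real (nu xs ys n) / real (p ^ n)) \<longlonglongrightarrow> F_threshold p R (Idl (set ys)) (Idl (set xs))"
proof -
  define v where "v n = real (nu xs ys n) / real (p ^ n)" for n
  have "v (n + e) \<le> v n + real (1 + length xs) / real (p ^ n)" for n e
  proof -
    have "real (nu xs ys (n + e)) \<le> real (p ^ e) * (real (nu xs ys n) + real (1 + length xs))"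
      using nu_growth[OF xs ys, of n e] by (metis add.assoc of_nat_add of_nat_le_iff of_nat_mult)
    then have "v (n + e) \<le> real (p ^ e) * (real (nu xs ys n) + real (1 + length xs)) / real (p ^ (n + e))"
      unfolding v_def by (rule divide_right_mono) simp
    also have "\<dots> = v n + real (1 + length xs) / real (p ^ n)"
      unfolding v_def power_add of_nat_mult add_divide_distrib[symmetric] using p_power_pos[of e] by simp
    finally show ?thesis .
  qed
  then have "convergent v"
    by (intro convergent_almost_decreasing[where w = "\<lambda>n. real (1 + length xs) / real (p ^ n)"] p_power_tendsto)
      (simp_all add: v_def)
  then have "v \<longlonglongrightarrow> lim v" by (simp add: convergent_LIMSEQ_iff)
  moreover have "(SUP t \<in> {..m}. real t) = real m" for m :: nat
    by (rule cSup_eq_maximum) auto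
  ultimately show ?thesis
    unfolding F_threshold_def nu_set[OF xs ys] v_def by simp
qed

lemma F_threshold_nonneg:
  assumes xs: "generates_primary R \<mm> xs" and ys: "generates_primary R \<mm> ys"
  shows "0 \<le> F_threshold p R (Idl (set ys)) (Idl (set xs))"
  using F_threshold_limit[OF xs ys] by (rule LIMSEQ_le_const) simp

lemma F_threshold_power_list:
  assumes xs: "generates_primary R \<mm> xs" and ys: "generates_primary R \<mm> ys" and q: "0 < (q::nat)"
  shows "real q * F_threshold p R (Idl (set ys)) (Idl (set (map (\<lambda>x. x [^] q) xs)))
    \<le> F_threshold p R (Idl (set ys)) (Idl (set xs))"
proof (rule LIMSEQ_le[OF tendsto_mult_left F_threshold_limit[OF xs ys]])
  have xsq: "generates_primary R \<mm> (map (\<lambda>x. x [^] q) xs)" using generates_primary_power_list[OF xs q] .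
  show "(\<lambda>n. real (nu (map (\<lambda>x. x [^] q) xs) ys n) / real (p ^ n)) \<longlonglongrightarrow>
      F_threshold p R (Idl (set ys)) (Idl (set (map (\<lambda>x. x [^] q) xs)))"
    by (rule F_threshold_limit[OF xsq ys])
  have "q * nu (map (\<lambda>x. x [^] q) xs) ys n \<le> nu xs ys n" for n
  proof -
    have "nu (map (\<lambda>x. x [^] q) xs) ys n \<in> {..nu (map (\<lambda>x. x [^] q) xs) ys n}" by simp
    then have "q * nu (map (\<lambda>x. x [^] q) xs) ys n \<in> {..nu xs ys n}"
      unfolding nu_set[OF xs ys, symmetric] nu_set[OF xsq ys, symmetric]
      using power_of_power_list_subset[OF generates_primary_closed[OF xs], of q] by blast
    then show ?thesis by simp
  qed
  then have "real q * (real (nu (map (\<lambda>x. x [^] q) xs) ys n) / real (p ^ n)) \<le> real (nu xs ys n) / real (p ^ n)" for n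
    by (simp add: divide_right_mono flip: of_nat_mult)
  then show "\<exists>N. \<forall>n\<ge>N. real q * (real (nu (map (\<lambda>x. x [^] q) xs) ys n) / real (p ^ n)) \<le> real (nu xs ys n) / real (p ^ n)"
    by blast
qed

lemma hk_limit:
  assumes ys: "generates_primary R \<mm> ys"
    and "(\<lambda>q. colength R (Idl (set (map (\<lambda>x. x [^] q) ys))) / real q ^ length ys) \<longlonglongrightarrow> e"
  shows "(\<lambda>n. colength R (frobenius_power p R (Idl (set ys)) n) / real (p ^ (n * length ys))) \<longlonglongrightarrow> e"
proof -
  have "strict_mono ((^) p)" using prime_gt_1_nat[OF prime_p] by (simp add: strict_mono_def)
  from LIMSEQ_subseq_LIMSEQ[OF assms(2) this] show ?thesis
    unfolding frobenius_power_Idl[OF generates_primary_closed[OF ys]]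
    by (simp add: comp_def power_mult)
qed

lemma hk_le_F_threshold:
  assumes xs: "generates_primary R \<mm> xs" and ys: "generates_primary R \<mm> ys"
    and len: "length xs = length ys"
    and e: "(\<lambda>n. colength R (frobenius_power p R (Idl (set ys)) n) / real (p ^ (n * length ys))) \<longlonglongrightarrow> e"
  shows "e \<le> colength R (Idl (set xs)) * F_threshold p R (Idl (set ys)) (Idl (set xs)) ^ length ys"
proof (rule LIMSEQ_le[OF e])
  define d where "d = length ys"
  let ?c = "F_threshold p R (Idl (set ys)) (Idl (set xs))"
  let ?L = "colength R (Idl (set xs))"
  have "(\<lambda>n. ?L * (real (nu xs ys n) / real (p ^ n) + real (1 + d) / real (p ^ n)) ^ d) \<longlonglongrightarrow> ?L * (?c + 0) ^ d"
    by (intro tendsto_intros F_threshold_limit[OF xs ys] p_power_tendsto)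
  then show "(\<lambda>n. ?L * (real (nu xs ys n) / real (p ^ n) + real (1 + d) / real (p ^ n)) ^ d) \<longlonglongrightarrow>
      ?L * ?c ^ length ys" by (simp add: d_def)
  have "colength R (frobenius_power p R (Idl (set ys)) n) / real (p ^ (n * length ys))
    \<le> ?L * (real (nu xs ys n) / real (p ^ n) + real (1 + d) / real (p ^ n)) ^ d" for n
  proof -
    define t where "t = nu xs ys n + 1"
    obtain N where N: "has_colength R ((Idl (set xs)) [^]\<^bsub>ideals_set R\<^esub> t) N"
      "real N \<le> ?L * real (card (simplex (length xs) t))"
      using has_colength_power[OF xs] .
    have id: "ideal ((Idl (set xs)) [^]\<^bsub>ideals_set R\<^esub> t) R"
      using ideal_power[OF genideal_ideal[OF generates_primary_closed[OF xs]]] .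
    have "t \<notin> {..nu xs ys n}" by (simp add: t_def)
    then have "(Idl (set xs)) [^]\<^bsub>ideals_set R\<^esub> t \<subseteq> frobenius_power p R (Idl (set ys)) n"
      unfolding nu_set[OF xs ys, symmetric] by blast
    then have "colength R (frobenius_power p R (Idl (set ys)) n) \<le> real N"
      using colength_antimono[OF id frobenius_power_subset_mm(1)[OF ys] _ N(1)]
        colength_eq[OF is_cring id N(1)] by simp
    also have "\<dots> \<le> ?L * real (card (simplex d t))" using N(2) len unfolding d_def by simp
    also have "\<dots> \<le> ?L * (real t + real d) ^ d"
    proof (intro mult_left_mono)
      have "1 * real (card (simplex d t)) \<le> fact d * real (card (simplex d t))"
        by (intro mult_right_mono fact_ge_1) simp
      also have "\<dots> \<le> (real t + real d) ^ d" using card_simplex_bounds(2)[of t d] by (simp add: t_def)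
      finally show "real (card (simplex d t)) \<le> (real t + real d) ^ d" by simp
    qed (simp add: colength_def)
    finally have "colength R (frobenius_power p R (Idl (set ys)) n) / real (p ^ (n * d))
      \<le> ?L * (real t + real d) ^ d / real (p ^ (n * d))" by (rule divide_right_mono) simp
    also have "\<dots> = ?L * ((real t + real d) / real (p ^ n)) ^ d" by (simp add: power_mult power_divide)
    finally show ?thesis unfolding d_def t_def by (simp add: add_divide_distrib add_ac)
  qed
  then show "\<exists>N. \<forall>n\<ge>N. colength R (frobenius_power p R (Idl (set ys)) n) / real (p ^ (n * length ys))
    \<le> ?L * (real (nu xs ys n) / real (p ^ n) + real (1 + d) / real (p ^ n)) ^ d" by blast
qed

end

section \<open>Parameter ideals and their quotients\<close>

lemma (in primeideal) pow_memD:
  assumes "x \<in> carrier R" "x [^] (n::nat) \<in> I"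
  shows "x \<in> I"
  using assms(2)
proof (induction n)
  case 0
  then show ?case using one_imp_carrier I_notcarr by auto
next
  case (Suc n)
  then show ?case using I_prime[of "x [^] n" x] assms(1) by auto
qed

lemma zero_FactRing: "\<zero>\<^bsub>R Quot I\<^esub> = I"
  by (simp add: FactRing_def)

context noetherian_local_char
begin

lemma prime_quotient_unique:
  assumes gen: "generates_primary R \<mm> xs" and P: "primeideal P (R Quot (Idl (set xs)))"
  shows "P = (+>) (Idl (set xs)) ` \<mm>"
proof -
  define I where "I = Idl (set xs)"
  have I: "ideal I R" unfolding I_def using genideal_ideal[OF generates_primary_closed[OF gen]] .
  interpret h: ring_hom_ring R "R Quot I" "(+>) I" using ideal.rcos_ring_hom_ring[OF I] .
  interpret P: primeideal P "R Quot I" using P unfolding I_def .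
  define M where "M = {r \<in> carrier R. I +> r \<in> P}"
  have M: "ideal M R" unfolding M_def by (rule h.ideal_vimage[OF P.ideal_axioms])
  have "\<mm> \<subseteq> M"
  proof
    fix y assume y: "y \<in> \<mm>"
    then have yc: "y \<in> carrier R" using ideal_subset[OF mm_ideal] by blast
    obtain n :: nat where n: "y [^] n \<in> I" using gen y unfolding generates_primary_def I_def by blast
    then have "I +> (y [^] n) = \<zero>\<^bsub>R Quot I\<^esub>"
      unfolding zero_FactRing using a_rcos_zero[OF I] by blast
    then have "(I +> y) [^]\<^bsub>R Quot I\<^esub> n = \<zero>\<^bsub>R Quot I\<^esub>" using h.hom_nat_pow[OF yc] by simp
    then have "(I +> y) [^]\<^bsub>R Quot I\<^esub> n \<in> P"
      by (rule ssubst) (rule additive_subgroup.zero_closed[OF ideal.axioms(1)[OF P.ideal_axioms]])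
    then have "I +> y \<in> P" by (rule P.pow_memD[OF h.hom_closed[OF yc]])
    then show "y \<in> M" unfolding M_def using yc by blast
  qed
  moreover have "M \<noteq> carrier R"
  proof
    assume "M = carrier R"
    then have "\<one>\<^bsub>R Quot I\<^esub> \<in> P" unfolding M_def using h.hom_one by (metis (mono_tags, lifting) mem_Collect_eq one_closed)
    then show False using P.one_imp_carrier P.I_notcarr by auto
  qed
  ultimately have "M = \<mm>"
    using maximalideal.I_maximal[OF maximal M] ideal_subset[OF M] by blast
  moreover have "P \<subseteq> (+>) I ` M"
  proof
    fix X assume "X \<in> P"
    moreover then obtain r where "r \<in> carrier R" "X = I +> r"
      using P.Icarr unfolding FactRing_def A_RCOSETS_def' by auto
    ultimately show "X \<in> (+>) I ` M" unfolding M_def by blast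
  qed
  ultimately show ?thesis unfolding I_def[symmetric] M_def by auto
qed

lemma krull_dim_quotient:
  assumes gen: "generates_primary R \<mm> xs"
  shows "krull_dim (R Quot (Idl (set xs))) = 0"
proof -
  have "n = 0" if "\<forall>i\<le>n. primeideal (P i) (R Quot (Idl (set xs)))" "\<forall>i<n. P i \<subset> P (Suc i)" for n P
  proof (rule ccontr)
    assume "n \<noteq> 0"
    then have "P 0 = P 1" "P 0 \<subset> P 1"
      using that prime_quotient_unique[OF gen, of "P 0"] prime_quotient_unique[OF gen, of "P 1"] by auto
    then show False by simp
  qed
  then have "krull_dim (R Quot (Idl (set xs))) \<le> 0"
    unfolding krull_dim_def by (intro SUP_least) (auto simp: zero_enat_def)
  then show ?thesis by simp
qed

lemma hk_quotient:
  assumes xs: "generates_primary R \<mm> xs" and ys: "generates_primary R \<mm> ys"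
  defines "I \<equiv> Idl (set xs)" and "J \<equiv> Idl (set ys)"
  shows "hk_multiplicity p (extended_ideal R I J) (R Quot I) = colength R I"
proof -
  have I: "ideal I R" unfolding I_def using genideal_ideal[OF generates_primary_closed[OF xs]] .
  have J: "ideal J R" unfolding J_def using genideal_ideal[OF generates_primary_closed[OF ys]] .
  interpret Q: cring "R Quot I" using ideal.quotient_is_cring[OF I is_cring] .
  interpret h: ring_hom_ring R "R Quot I" "(+>) I" using ideal.rcos_ring_hom_ring[OF I] .
  have zero: "\<zero>\<^bsub>R Quot I\<^esub> = I" by (rule zero_FactRing)
  obtain us where "parameter_filtration R \<mm> xs us" and len: "has_colength R I (length us)"
    using exists_parameter_filtration[OF xs] unfolding I_def .
  have "has_colength (R Quot I) {\<zero>\<^bsub>R Quot I\<^esub>} (length us)"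
    using len unfolding has_colength_def ideal_chain_quotient[OF I] .
  then have cl: "colength (R Quot I) {\<zero>\<^bsub>R Quot I\<^esub>} = colength R I"
    using colength_eq[OF Q.is_cring Q.zeroideal] colength_eq[OF is_cring I len] by simp
  have ext: "extended_ideal R I J \<subseteq> (+>) I ` J"
    unfolding extended_ideal_def by (rule Q.genideal_minimal[OF ring_ideal_imp_quot_ideal[OF I J]]) simp
  have "set ys \<subseteq> \<mm>" using ys unfolding generates_primary_def by simp
  then obtain M :: nat where M: "\<forall>y\<in>set ys. \<forall>k\<ge>M. y [^] k \<in> I"
    using uniform_power[OF xs] unfolding I_def by blast
  have frob: "frobenius_power p (R Quot I) (extended_ideal R I J) n = {\<zero>\<^bsub>R Quot I\<^esub>}" if "M \<le> n" for n
  proof -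
    have "n < p ^ n" using prime_gt_1_nat[OF prime_p] by (simp add: power_gt_expt)
    then have Mn: "M \<le> p ^ n" using that by simp
    have "X [^]\<^bsub>R Quot I\<^esub> (p ^ n) = \<zero>\<^bsub>R Quot I\<^esub>" if X: "X \<in> extended_ideal R I J" for X
    proof -
      obtain x where x: "x \<in> J" "X = I +> x" using X ext by blast
      have xc: "x \<in> carrier R" using x(1) ideal_subset[OF J] by blast
      have "x [^] (p ^ n) \<in> Idl ((\<lambda>x. x [^] (p ^ n)) ` set ys)"
        using frobenius_pow_mem_Idl[OF generates_primary_closed[OF ys]] x(1) unfolding J_def by blast
      moreover have "Idl ((\<lambda>x. x [^] (p ^ n)) ` set ys) \<subseteq> I"
        using M Mn by (intro genideal_minimal[OF I]) auto
      ultimately have "I +> (x [^] (p ^ n)) = I" using a_rcos_zero[OF I] by blast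
      then show ?thesis unfolding x(2) zero using h.hom_nat_pow[OF xc, of "p ^ n"] by simp
    qed
    then have "frobenius_power p (R Quot I) (extended_ideal R I J) n \<subseteq> {\<zero>\<^bsub>R Quot I\<^esub>}"
      unfolding frobenius_power_def by (intro Q.genideal_minimal[OF Q.zeroideal]) auto
    moreover have "\<zero>\<^bsub>R Quot I\<^esub> \<in> frobenius_power p (R Quot I) (extended_ideal R I J) n"
      unfolding frobenius_power_def genideal_def
      by (auto intro: additive_subgroup.zero_closed ideal.axioms(1))
    ultimately show ?thesis by blast
  qed
  have kd: "the_enat (krull_dim (R Quot I)) = 0"
    unfolding I_def krull_dim_quotient[OF xs] by (simp add: zero_enat_def)
  have "\<forall>\<^sub>F n in sequentially. colength R I =
      colength (R Quot I) (frobenius_power p (R Quot I) (extended_ideal R I J) n)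
        / real (p ^ (n * the_enat (krull_dim (R Quot I))))"
    using eventually_ge_at_top[of M] by eventually_elim (simp add: frob cl kd)
  then have "(\<lambda>n. colength (R Quot I) (frobenius_power p (R Quot I) (extended_ideal R I J) n)
        / real (p ^ (n * the_enat (krull_dim (R Quot I))))) \<longlonglongrightarrow> colength R I"
    by (rule Lim_transform_eventually[OF tendsto_const])
  then show ?thesis unfolding hk_multiplicity_def by (rule limI)
qed

lemma parameter_ideal_Idl:
  assumes gen: "generates_primary R \<mm> xs" and dim: "krull_dim R = enat (length xs)"
  shows "parameter_ideal R \<mm> (Idl (set xs))"
proof -
  define I where "I = Idl (set xs)"
  have I: "ideal I R" unfolding I_def using genideal_ideal[OF generates_primary_closed[OF gen]] .
  have sub: "set xs \<subseteq> \<mm>" and pow: "\<And>y. y \<in> \<mm> \<Longrightarrow> \<exists>n::nat. y [^] n \<in> I"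
    using gen unfolding generates_primary_def I_def by auto
  have Im: "I \<subseteq> \<mm>" unfolding I_def using genideal_minimal[OF mm_ideal sub] .
  have rad: "radical R I = \<mm>"
  proof
    show "radical R I \<subseteq> \<mm>"
      unfolding radical_def using primeideal.pow_memD[OF maximalideal_prime[OF maximal]] Im by blast
    show "\<mm> \<subseteq> radical R I"
      unfolding radical_def using pow ideal_subset[OF mm_ideal] by blast
  qed
  have "x \<in> I" if xy: "x \<in> carrier R" "y \<in> carrier R" "x \<otimes> y \<in> I" "y \<notin> \<mm>" for x y
  proof -
    obtain s t where st: "s \<in> carrier R" "t \<in> \<mm>" "\<one> = t \<oplus> s \<otimes> y"
      using unit_modulo_maximal[OF maximal xy(2,4)] .
    have t: "t \<in> carrier R" using st ideal_subset[OF mm_ideal] by blast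
    have "\<exists>s\<in>carrier R. \<one> = t [^] n \<oplus> s \<otimes> y" for n :: nat
    proof (induction n)
      case 0
      show ?case by (intro bexI[of _ \<zero>]) (use xy in auto)
    next
      case (Suc n)
      then obtain r where r: "r \<in> carrier R" "\<one> = t [^] n \<oplus> r \<otimes> y" by blast
      have "t [^] n = t [^] n \<otimes> (t \<oplus> s \<otimes> y)" unfolding st(3)[symmetric] using t by simp
      also have "\<dots> = t [^] Suc n \<oplus> (t [^] n \<otimes> s) \<otimes> y"
        using t st xy by (simp add: r_distr m_assoc)
      finally have "\<one> = t [^] Suc n \<oplus> (t [^] n \<otimes> s) \<otimes> y \<oplus> r \<otimes> y" using r(2) by simp
      also have "\<dots> = t [^] Suc n \<oplus> (t [^] n \<otimes> s \<oplus> r) \<otimes> y"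
        using t st xy r by (simp add: l_distr a_assoc del: nat_pow_Suc)
      finally show ?case using t st r by blast
    qed
    moreover obtain n :: nat where n: "t [^] n \<in> I" using pow[OF st(2)] by blast
    ultimately obtain r where r: "r \<in> carrier R" "\<one> = t [^] n \<oplus> r \<otimes> y" by blast
    have "x = x \<otimes> (t [^] n \<oplus> r \<otimes> y)" unfolding r(2)[symmetric] using xy by simp
    also have "\<dots> = x \<otimes> t [^] n \<oplus> r \<otimes> (x \<otimes> y)" using xy t r by (simp add: r_distr m_ac)
    also have "\<dots> \<in> I"
      using n xy r ideal.I_l_closed[OF I] additive_subgroup.a_closed[OF ideal.axioms(1)[OF I]] by simp
    finally show ?thesis .
  qed
  moreover have "I \<noteq> carrier R" using Im one_notin_mm by blast
  ultimately have "m_primary R \<mm> I" unfolding m_primary_def primary_ideal_def rad using I by blast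
  then show ?thesis
    using sub dim unfolding parameter_ideal_def system_of_parameters_def I_def by (metis order_refl)
qed

lemma parameter_ideal_iff:
  assumes dim: "krull_dim R = enat d"
  shows "parameter_ideal R \<mm> I \<longleftrightarrow> (\<exists>xs. generates_primary R \<mm> xs \<and> length xs = d \<and> I = Idl (set xs))"
proof
  assume "parameter_ideal R \<mm> I"
  then obtain xs where xs: "set xs \<subseteq> \<mm>" "length xs = d" "I = Idl (set xs)" "radical R I = \<mm>"
    using dim unfolding parameter_ideal_def system_of_parameters_def m_primary_def by auto
  then have "generates_primary R \<mm> xs" unfolding generates_primary_def radical_def by blast
  then show "\<exists>xs. generates_primary R \<mm> xs \<and> length xs = d \<and> I = Idl (set xs)" using xs by blast
next
  assume "\<exists>xs. generates_primary R \<mm> xs \<and> length xs = d \<and> I = Idl (set xs)"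
  then show "parameter_ideal R \<mm> I" using parameter_ideal_Idl dim by blast
qed

lemma hs_hk_multiplicity:
  assumes xs: "generates_primary R \<mm> xs" and dim: "krull_dim R = enat (length xs)"
  defines "e \<equiv> hs_multiplicity (Idl (set xs)) R"
  shows "hk_multiplicity p (Idl (set xs)) R = e"
    and "0 \<le> e" and "e \<le> colength R (Idl (set xs))"
    and "(\<lambda>q. colength R (Idl (set (map (\<lambda>x. x [^] q) xs))) / real q ^ length xs) \<longlonglongrightarrow> e"
proof -
  obtain e' where e': "0 \<le> e'" "e' \<le> colength R (Idl (set xs))"
    "(\<lambda>n. fact (length xs) * colength R ((Idl (set xs)) [^]\<^bsub>ideals_set R\<^esub> n) / real n ^ length xs) \<longlonglongrightarrow> e'"
    "(\<lambda>q. colength R (Idl (set (map (\<lambda>x. x [^] q) xs))) / real q ^ length xs) \<longlonglongrightarrow> e'"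
    by (rule multiplicity_limits[OF xs])
  have eq: "e = e'"
    unfolding e_def hs_multiplicity_def dim the_enat.simps using e'(3) by (rule limI)
  have "hk_multiplicity p (Idl (set xs)) R = e'"
    unfolding hk_multiplicity_def dim the_enat.simps using hk_limit[OF xs e'(4)] by (rule limI)
  then show "hk_multiplicity p (Idl (set xs)) R = e" "0 \<le> e" "e \<le> colength R (Idl (set xs))"
    "(\<lambda>q. colength R (Idl (set (map (\<lambda>x. x [^] q) xs))) / real q ^ length xs) \<longlonglongrightarrow> e"
    unfolding eq using e' by auto
qed

lemma hs_bound_iff:
  fixes c e e' :: real
  assumes "0 \<le> c" "0 \<le> e" and "c = 0 \<Longrightarrow> 0 < d \<Longrightarrow> e' = 0"
  shows "real d ^ d / c ^ d * e' \<le> e \<longleftrightarrow> e' \<le> (c / real d) ^ d * e"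
proof (cases "d = 0 \<or> 0 < c")
  case True
  then have "0 < (c / real d) ^ d" by (cases "d = 0") auto
  moreover have "real d ^ d / c ^ d = 1 / (c / real d) ^ d" by (simp add: power_divide)
  moreover have "1 / k * e' \<le> e \<longleftrightarrow> e' \<le> k * e" if "0 < k" for k :: real
    using that by (simp add: field_simps)
  ultimately show ?thesis by metis
qed (use assms in \<open>auto simp: zero_power\<close>)

end

theorem proposition8p17:
  fixes R :: "('a, 'b) ring_scheme" and \<mm> :: "'a set" and p d :: nat
  assumes "local_ring R \<mm>"
    and "noetherian_ring R"
    and "Factorial_Ring.prime p"
    and "has_characteristic R p"
    and "F_finite p R"
    and "krull_dim R = enat d"
  shows "(\<forall>I J. parameter_ideal R \<mm> I \<and> parameter_ideal R \<mm> J \<longrightarrow>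
            hs_multiplicity I R \<ge> real d ^ d / F_threshold p R J I ^ d * hs_multiplicity J R)
     \<longleftrightarrow>
         (\<forall>I J. parameter_ideal R \<mm> I \<and> parameter_ideal R \<mm> J \<longrightarrow>
            hk_multiplicity p J R
              \<le> (F_threshold p R J I / real d) ^ d
                  * hk_multiplicity p (extended_ideal R I J) (R Quot I))"
    (is "?HS \<longleftrightarrow> ?HK")
proof -
  have "add_pow R p \<one>\<^bsub>R\<^esub> = \<zero>\<^bsub>R\<^esub>" using assms(4) unfolding has_characteristic_def by simp
  then interpret noetherian_local_char R \<mm> p
    using assms(1-3) unfolding local_ring_def
    by (intro noetherian_local_char.intro noetherian_local.intro noetherian_local_axioms.intro
        noetherian_local_char_axioms.intro) auto
  define e where "e xs = hs_multiplicity (Idl\<^bsub>R\<^esub> (set xs)) R" for xs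
  define c where "c xs ys = F_threshold p R (Idl\<^bsub>R\<^esub> (set ys)) (Idl\<^bsub>R\<^esub> (set xs))" for xs ys
  define l where "l xs = colength R (Idl\<^bsub>R\<^esub> (set xs))" for xs
  define param where "param xs \<longleftrightarrow> generates_primary R \<mm> xs \<and> length xs = d" for xs
  have hk: "hk_multiplicity p (Idl\<^bsub>R\<^esub> (set xs)) R = e xs" and e_nonneg: "0 \<le> e xs" and e_le: "e xs \<le> l xs"
    and e_lim: "(\<lambda>q. l (map (\<lambda>x. x [^]\<^bsub>R\<^esub> q) xs) / real q ^ d) \<longlonglongrightarrow> e xs" if "param xs" for xs
    using hs_hk_multiplicity[of xs] that assms(6) unfolding param_def e_def l_def by auto
  have c_nonneg: "0 \<le> c xs ys" if "param xs" "param ys" for xs ys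
    using F_threshold_nonneg that unfolding param_def c_def by blast
  have e_zero: "e ys = 0" if par: "param xs" "param ys" and "c xs ys = 0" "0 < d" for xs ys
  proof -
    obtain e' where e': "(\<lambda>q. colength R (Idl\<^bsub>R\<^esub> (set (map (\<lambda>x. x [^]\<^bsub>R\<^esub> q) ys))) / real q ^ length ys) \<longlonglongrightarrow> e'"
      "e' = e ys" using e_lim[OF par(2)] par(2) unfolding l_def param_def by auto
    have "e ys \<le> l xs * c xs ys ^ length ys"
      using hk_le_F_threshold[of xs ys, OF _ _ _ hk_limit[OF _ e'(1)]] par e'(2)
      unfolding param_def l_def c_def by simp
    then show ?thesis using that e_nonneg[OF par(2)] unfolding param_def by (simp add: zero_power)
  qed
  have HS: "?HS \<longleftrightarrow> (\<forall>xs ys. param xs \<and> param ys \<longrightarrow> e ys \<le> (c xs ys / real d) ^ d * e xs)"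
    (is "_ \<longleftrightarrow> ?A")
  proof -
    have "?HS \<longleftrightarrow> (\<forall>xs ys. param xs \<and> param ys \<longrightarrow> real d ^ d / c xs ys ^ d * e ys \<le> e xs)"
      unfolding parameter_ideal_iff[OF assms(6)] param_def e_def c_def by blast
    also have "\<dots> \<longleftrightarrow> ?A"
      using hs_bound_iff[OF c_nonneg e_nonneg e_zero] by blast
    finally show ?thesis .
  qed
  have HK: "?HK \<longleftrightarrow> (\<forall>xs ys. param xs \<and> param ys \<longrightarrow> e ys \<le> (c xs ys / real d) ^ d * l xs)"
    (is "_ \<longleftrightarrow> ?B")
  proof -
    have "?HK \<longleftrightarrow> (\<forall>xs ys. param xs \<and> param ys \<longrightarrow> hk_multiplicity p (Idl\<^bsub>R\<^esub> (set ys)) R \<le> (c xs ys / real d) ^ d *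
        hk_multiplicity p (extended_ideal R (Idl\<^bsub>R\<^esub> (set xs)) (Idl\<^bsub>R\<^esub> (set ys))) (R Quot (Idl\<^bsub>R\<^esub> (set xs))))"
      unfolding parameter_ideal_iff[OF assms(6)] param_def c_def by blast
    also have "\<dots> \<longleftrightarrow> ?B"
      using hk hk_quotient unfolding param_def l_def by simp
    finally show ?thesis .
  qed
  have "?A \<longleftrightarrow> ?B"
  proof
    assume A: ?A
    show ?B
    proof (intro allI impI)
      fix xs ys assume par: "param xs \<and> param ys"
      then have "e ys \<le> (c xs ys / real d) ^ d * e xs" using A by blast
      also have "\<dots> \<le> (c xs ys / real d) ^ d * l xs"
        using par e_le c_nonneg by (intro mult_left_mono) auto
      finally show "e ys \<le> (c xs ys / real d) ^ d * l xs" .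
    qed
  next
    assume B: ?B
    show ?A
    proof (intro allI impI)
      fix xs ys assume par: "param xs \<and> param ys"
      let ?xq = "\<lambda>q. map (\<lambda>x. x [^]\<^bsub>R\<^esub> (q::nat)) xs"
      have "e ys \<le> (c xs ys / real d) ^ d * (l (?xq q) / real q ^ d)" if q: "0 < q" for q
      proof -
        have par': "param (?xq q)"
          using par generates_primary_power_list[OF _ q] unfolding param_def by simp
        have "real q * c (?xq q) ys \<le> c xs ys"
          using F_threshold_power_list[OF _ _ q] par unfolding param_def c_def by blast
        then have "c (?xq q) ys / real d \<le> (c xs ys / real d) / real q"
          using q by (cases "d = 0") (simp_all add: field_simps)
        then have "(c (?xq q) ys / real d) ^ d \<le> ((c xs ys / real d) / real q) ^ d"
          using c_nonneg par par' by (intro power_mono) auto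
        then have "(c (?xq q) ys / real d) ^ d * l (?xq q) \<le> ((c xs ys / real d) / real q) ^ d * l (?xq q)"
          by (intro mult_right_mono) (simp_all add: l_def colength_def)
        moreover have "e ys \<le> (c (?xq q) ys / real d) ^ d * l (?xq q)" using B par par' by blast
        ultimately show ?thesis by (simp add: power_divide power_mult_distrib)
      qed
      then have "\<exists>N. \<forall>q\<ge>N. e ys \<le> (c xs ys / real d) ^ d * (l (?xq q) / real q ^ d)"
        by (intro exI[of _ 1]) auto
      moreover have "(\<lambda>q. (c xs ys / real d) ^ d * (l (?xq q) / real q ^ d)) \<longlonglongrightarrow> (c xs ys / real d) ^ d * e xs"
        using par by (intro tendsto_mult_left e_lim) simp
      ultimately show "e ys \<le> (c xs ys / real d) ^ d * e xs" by (intro LIMSEQ_le_const)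
    qed
  qed
  then show ?thesis unfolding HS HK .
qed

end
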